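(* Let $1<p\le2\le q<\infty$ and assume $$\sup_{\xi\in\mathcal{I}}\frac{\|v_\xi\|_{L^\infty(\overline{M})}}{\|u_\xi\|_{L^\infty(\overline{M})}}<\infty\quad\text{and}\quad\sup_{\xi\in\mathcal{I}}\frac{\|u_\xi\|_{L^\infty(\overline{M})}}{\|v_\xi\|_{L^\infty(\overline{M})}}<\infty.$$ Let $A:C^\infty_L(\overline{M})\to C^\infty_L(\overline{M})$ be an $L$-Fourier multiplier, i.e. $\mathcal{F}_L(Af)(\xi)=\sigma_{A,L}(\xi)\mathcal{F}_Lf(\xi)$ for all $\xi\in\mathcal{I}$, for some function $\sigma_{A,L}:\mathcal{I}\to\mathbb{C}$. Then $$\|A\|_{\mathscr{B}(L^p(\overline{M}),L^q(\overline{M}))}\lesssim\sup_{s>0}s\Big(\sum_{\xi\in\mathcal{I}:\ |\sigma_{A,L}(\xi)|\ge s}\max\{\|u_\xi\|^2_{L^\infty(\overline{M})},\|v_\xi\|^2_{L^\infty(\overline{M})}\}\Big)^{\frac1p-\frac1q}.$$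
   Context: Standing setup: $\overline{M}$ is a smooth orientable manifold with (possibly empty) boundary and smooth density $dx$. $L$ is a pseudo-differential operator on its interior with boundary conditions giving discrete spectrum $\{\lambda_\xi\}_{\xi\in\mathcal{I}}$, eigenfunctions $u_\xi$ of $L$ and $v_\xi$ of $L^*$ ($L^*v_\xi=\overline{\lambda_\xi}v_\xi$), $\|u_\xi\|_{L^2}=\|v_\xi\|_{L^2}=1$, $(u_\xi,v_\eta)_{L^2}=\delta_{\xi\eta}$, $\{u_\xi\}$ a Riesz basis of $L^2(\overline{M})$, $u_\xi,v_\xi\in L^\infty$. $C^\infty_L(\overline{M})=\bigcap_k\mathrm{Dom}(L^k)$; $\mathcal{F}_Lf(\xi):=\int_{\overline{M}}f\overline{v_\xi}\,dx$. $\mathscr{B}(X,Y)$ denotes bounded operators with operator norm. *)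

theory Defs
  imports "HOL-Probability.Probability"
begin

text \<open>Power of an extended nonnegative real with a nonnegative real exponent.
  Convention: finite values use real powr (so 0 to any power is 0);
  infinity to a positive power is infinity, infinity to the power 0 is 1.\<close>
definition epow :: "ennreal \<Rightarrow> real \<Rightarrow> ennreal" where
  "epow x r = (if x = \<infinity> then (if r = 0 then 1 else \<infinity>) else ennreal (enn2real x powr r))"

definition Lp_norm :: "'a measure \<Rightarrow> real \<Rightarrow> ('a \<Rightarrow> complex) \<Rightarrow> ennreal" where
  "Lp_norm M p f = epow (\<integral>\<^sup>+ x. ennreal (cmod (f x) powr p) \<partial>M) (1 / p)"

definition in_Lp :: "'a measure \<Rightarrow> real \<Rightarrow> ('a \<Rightarrow> complex) \<Rightarrow> bool" where
  "in_Lp M p f \<longleftrightarrow> f \<in> borel_measurable M \<and> (\<integral>\<^sup>+ x. ennreal (cmod (f x) powr p) \<partial>M) < \<infinity>"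

definition Linf_enorm :: "'a measure \<Rightarrow> ('a \<Rightarrow> complex) \<Rightarrow> ereal" where
  "Linf_enorm M f = esssup M (\<lambda>x. ereal (cmod (f x)))"

definition in_Linf :: "'a measure \<Rightarrow> ('a \<Rightarrow> complex) \<Rightarrow> bool" where
  "in_Linf M f \<longleftrightarrow> f \<in> borel_measurable M \<and> Linf_enorm M f < \<infinity>"

text \<open>L^\<infinity> norm as a real number (meaningful for functions in L^\<infinity>).\<close>
definition Linf_norm :: "'a measure \<Rightarrow> ('a \<Rightarrow> complex) \<Rightarrow> real" where
  "Linf_norm M f = real_of_ereal (Linf_enorm M f)"

definition L2_inner :: "'a measure \<Rightarrow> ('a \<Rightarrow> complex) \<Rightarrow> ('a \<Rightarrow> complex) \<Rightarrow> complex" where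
  "L2_inner M f g = (\<integral>x. f x * cnj (g x) \<partial>M)"

definition L2_norm :: "'a measure \<Rightarrow> ('a \<Rightarrow> complex) \<Rightarrow> real" where
  "L2_norm M f = sqrt (\<integral>x. (cmod (f x))\<^sup>2 \<partial>M)"

definition riesz_basis :: "'a measure \<Rightarrow> 'i set \<Rightarrow> ('i \<Rightarrow> 'a \<Rightarrow> complex) \<Rightarrow> bool" where
  "riesz_basis M I u \<longleftrightarrow>
     (\<forall>\<xi>\<in>I. in_Lp M 2 (u \<xi>)) \<and>
     (\<exists>a b. 0 < a \<and> a \<le> b \<and>
        (\<forall>F c. finite F \<longrightarrow> F \<subseteq> I \<longrightarrow>
           a * (\<Sum>\<xi>\<in>F. (cmod (c \<xi>))\<^sup>2) \<le> (L2_norm M (\<lambda>x. \<Sum>\<xi>\<in>F. c \<xi> * u \<xi> x))\<^sup>2 \<and>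
           (L2_norm M (\<lambda>x. \<Sum>\<xi>\<in>F. c \<xi> * u \<xi> x))\<^sup>2 \<le> b * (\<Sum>\<xi>\<in>F. (cmod (c \<xi>))\<^sup>2))) \<and>
     (\<forall>f. in_Lp M 2 f \<longrightarrow> (\<forall>\<epsilon>>0. \<exists>F c. finite F \<and> F \<subseteq> I \<and>
           L2_norm M (\<lambda>x. f x - (\<Sum>\<xi>\<in>F. c \<xi> * u \<xi> x)) < \<epsilon>))"

fun Dom_pow :: "'a measure \<Rightarrow> ('a \<Rightarrow> complex) set \<Rightarrow> (('a \<Rightarrow> complex) \<Rightarrow> ('a \<Rightarrow> complex))
                 \<Rightarrow> nat \<Rightarrow> ('a \<Rightarrow> complex) set" where
  "Dom_pow M D L 0 = {f. in_Lp M 2 f}"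
| "Dom_pow M D L (Suc k) = {f \<in> D. L f \<in> Dom_pow M D L k}"

definition Cinf_L :: "'a measure \<Rightarrow> ('a \<Rightarrow> complex) set \<Rightarrow> (('a \<Rightarrow> complex) \<Rightarrow> ('a \<Rightarrow> complex))
                 \<Rightarrow> ('a \<Rightarrow> complex) set" where
  "Cinf_L M D L = (\<Inter>k. Dom_pow M D L k)"

definition FT_L :: "'a measure \<Rightarrow> ('i \<Rightarrow> 'a \<Rightarrow> complex) \<Rightarrow> ('a \<Rightarrow> complex) \<Rightarrow> 'i \<Rightarrow> complex" where
  "FT_L M v f \<xi> = (\<integral>x. f x * cnj (v \<xi> x) \<partial>M)"

text \<open>Norm in B(L^p, L^q) of an operator A defined on the subspace S (here S = C^\<infinity>_L):
  the least constant c with \<parallel>A f\<parallel>_q \<le> c \<parallel>f\<parallel>_p for all f \<in> S.\<close>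
definition op_norm_pq :: "'a measure \<Rightarrow> real \<Rightarrow> real \<Rightarrow> ('a \<Rightarrow> complex) set
                 \<Rightarrow> (('a \<Rightarrow> complex) \<Rightarrow> ('a \<Rightarrow> complex)) \<Rightarrow> ennreal" where
  "op_norm_pq M p q S A = Inf {c. \<forall>f\<in>S. Lp_norm M q (A f) \<le> c * Lp_norm M p f}"

end

(* By duality it suffices to bound the pairing of A f with g in terms of the L^p norm of f and the
   L^q' norm of g. Expanding A f in the Riesz basis, the pairing is a sum of |sigma| |f^| |g~|, where
   f^ and g~ are the coefficients against v and u. Writing |sigma| = |sigma|^theta |sigma|^(1-theta)
   with theta (1/p - 1/q) = 1/p - 1/2 and applying Cauchy-Schwarz reduces everything to one
   Paley-type inequality (target exponent 2, source exponent p or q', both in (1,2]):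
   the sum of phi^2 |f^|^2 is at most C K^2 ||f||_p^2 whenever s W(phi >= s)^(1/p - 1/2) <= K, W being
   the sum of the weights. The latter is a Marcinkiewicz argument over dyadic levels of phi, resting
   only on the Bessel inequality and on |f^| <= sqrt w ||f||_1, so no complex interpolation is used. *)
theory Submission
  imports Defs
begin

section \<open>Square integrable functions\<close>

text \<open>The exponents fit because a superlevel set of a power of |sigma| is again a superlevel
  set of |sigma|: a bound S for s W^(1/p - 1/q) becomes S^theta with exponent 1/p - 1/2, and the
  complementary power gives S^(1 - theta) with exponent 1/2 - 1/q = 1/q' - 1/2. The two Paley
  constants S^theta and S^(1 - theta) multiply back to S. One weight serves the coefficients of f
  against v and those of g against u, which is why it dominates both sup norms. The obstacle is that
  the Riesz basis is given by two inequalities for finite sums and by density, not as a convergent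
  expansion. All estimates are therefore made on finite index sets, with bounds independent of the
  set, and a finite combination plus a small L^2 remainder stands in for the expansion. In the same
  way A f is known only to lie in L^2, so its L^q norm is reached through truncated test functions.
  The constants depend only on p, q and the two Riesz bounds, so the final constant can be fixed
  before the operator and its symbol.\<close>

lemma in_Lp_2_iff:
  "in_Lp M 2 f \<longleftrightarrow> f \<in> borel_measurable M \<and> integrable M (\<lambda>x. (cmod (f x))\<^sup>2)"
proof -
  have "(\<integral>\<^sup>+ x. ennreal (cmod (f x) powr 2) \<partial>M) = (\<integral>\<^sup>+ x. ennreal (norm ((cmod (f x))\<^sup>2)) \<partial>M)"
    by (intro nn_integral_cong) (simp flip: powr_numeral)
  then show ?thesis
    unfolding in_Lp_def integrable_iff_bounded by auto
qed

lemma L2_norm_nonneg [simp]: "0 \<le> L2_norm M f"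
  by (simp add: L2_norm_def)

lemma L2_norm_square: "(L2_norm M f)\<^sup>2 = (\<integral>x. (cmod (f x))\<^sup>2 \<partial>M)"
  by (simp add: L2_norm_def)

lemma in_Lp_2_dominated:
  assumes "in_Lp M 2 f" "g \<in> borel_measurable M" "\<And>x. cmod (g x) \<le> c * cmod (f x)"
  shows "in_Lp M 2 g"
proof -
  have "integrable M (\<lambda>x. c\<^sup>2 * (cmod (f x))\<^sup>2)"
    using assms(1) by (simp add: in_Lp_2_iff)
  moreover have "(cmod (g x))\<^sup>2 \<le> c\<^sup>2 * (cmod (f x))\<^sup>2" for x
    using power_mono[OF assms(3)[of x], of 2] by (simp add: power_mult_distrib)
  ultimately have "integrable M (\<lambda>x. (cmod (g x))\<^sup>2)"
    using assms(2) by (elim Bochner_Integration.integrable_bound) auto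
  then show ?thesis
    using assms(2) by (simp add: in_Lp_2_iff)
qed

lemma in_Lp_2_add:
  assumes f: "in_Lp M 2 f" and g: "in_Lp M 2 g"
  shows "in_Lp M 2 (\<lambda>x. f x + g x)"
proof -
  have [measurable]: "f \<in> borel_measurable M" "g \<in> borel_measurable M"
    using f g by (auto simp: in_Lp_2_iff)
  have "integrable M (\<lambda>x. 2 * (cmod (f x))\<^sup>2 + 2 * (cmod (g x))\<^sup>2)"
    using f g by (simp add: in_Lp_2_iff)
  moreover have "(cmod (f x + g x))\<^sup>2 \<le> 2 * (cmod (f x))\<^sup>2 + 2 * (cmod (g x))\<^sup>2" for x
  proof -
    have "(cmod (f x + g x))\<^sup>2 \<le> (cmod (f x) + cmod (g x))\<^sup>2"
      by (intro power_mono norm_triangle_ineq) auto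
    also have "\<dots> \<le> 2 * (cmod (f x))\<^sup>2 + 2 * (cmod (g x))\<^sup>2"
      using zero_le_power2[of "cmod (f x) - cmod (g x)"] by (simp add: power2_eq_square algebra_simps)
    finally show ?thesis .
  qed
  ultimately have "integrable M (\<lambda>x. (cmod (f x + g x))\<^sup>2)"
    by (elim Bochner_Integration.integrable_bound) auto
  then show ?thesis
    by (simp add: in_Lp_2_iff)
qed

lemma in_Lp_2_cmult: "in_Lp M 2 f \<Longrightarrow> in_Lp M 2 (\<lambda>x. c * f x)"
  by (rule in_Lp_2_dominated[where c = "cmod c"]) (auto simp: in_Lp_2_iff norm_mult)

lemma in_Lp_2_diff: "in_Lp M 2 f \<Longrightarrow> in_Lp M 2 g \<Longrightarrow> in_Lp M 2 (\<lambda>x. f x - g x)"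
  using in_Lp_2_add[of M f "\<lambda>x. (-1) * g x"] in_Lp_2_cmult[of M g "-1"] by simp

lemma in_Lp_2_sum:
  assumes "finite F" "\<And>i. i \<in> F \<Longrightarrow> in_Lp M 2 (u i)"
  shows "in_Lp M 2 (\<lambda>x. \<Sum>i\<in>F. c i * u i x)"
  using assms
proof (induction F rule: finite_induct)
  case empty
  then show ?case by (simp add: in_Lp_2_iff)
next
  case (insert i F)
  then show ?case by (simp add: in_Lp_2_add in_Lp_2_cmult)
qed

lemma in_Lp_2_integrable_mult:
  assumes f: "in_Lp M 2 f" and g: "in_Lp M 2 g"
  shows "integrable M (\<lambda>x. cmod (f x) * cmod (g x))"
    and "integrable M (\<lambda>x. f x * cnj (g x))"
proof -
  have [measurable]: "f \<in> borel_measurable M" "g \<in> borel_measurable M"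
    using f g by (auto simp: in_Lp_2_iff)
  have i: "integrable M (\<lambda>x. (cmod (f x))\<^sup>2 + (cmod (g x))\<^sup>2)"
    using f g by (simp add: in_Lp_2_iff)
  have b: "cmod (f x) * cmod (g x) \<le> (cmod (f x))\<^sup>2 + (cmod (g x))\<^sup>2" for x
  proof -
    have "2 * (cmod (f x) * cmod (g x)) \<le> (cmod (f x))\<^sup>2 + (cmod (g x))\<^sup>2"
      using zero_le_power2[of "cmod (f x) - cmod (g x)"] by (simp add: power2_eq_square algebra_simps)
    moreover have "0 \<le> cmod (f x) * cmod (g x)" by simp
    ultimately show ?thesis by linarith
  qed
  show "integrable M (\<lambda>x. cmod (f x) * cmod (g x))"
    using b by (intro Bochner_Integration.integrable_bound[OF i]) auto
  show "integrable M (\<lambda>x. f x * cnj (g x))"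
  proof (intro Bochner_Integration.integrable_bound[OF i])
    have "cnj \<in> borel_measurable borel"
      by (intro borel_measurable_continuous_onI continuous_intros)
    then show "(\<lambda>x. f x * cnj (g x)) \<in> borel_measurable M"
      using measurable_compose[of g M borel cnj borel] by (intro borel_measurable_times) auto
  qed (use b in \<open>auto simp: norm_mult\<close>)
qed

lemma L2_Cauchy_Schwarz_cmod:
  assumes f: "in_Lp M 2 f" and g: "in_Lp M 2 g"
  shows "(\<integral>x. cmod (f x) * cmod (g x) \<partial>M) \<le> L2_norm M f * L2_norm M g"
proof (rule power2_le_imp_le)
  have [measurable]: "f \<in> borel_measurable M" "g \<in> borel_measurable M"
    using f g by (auto simp: in_Lp_2_iff)
  have sq: "(\<integral>\<^sup>+x. (ennreal (cmod (h x)))\<^sup>2 \<partial>M) = ennreal ((L2_norm M h)\<^sup>2)" if "in_Lp M 2 h" for h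
    using that unfolding in_Lp_2_iff L2_norm_square
    by (simp add: ennreal_power nn_integral_eq_integral)
  have "ennreal ((\<integral>x. cmod (f x) * cmod (g x) \<partial>M)\<^sup>2)
      = (\<integral>\<^sup>+x. ennreal (cmod (f x)) * ennreal (cmod (g x)) \<partial>M)\<^sup>2"
    using in_Lp_2_integrable_mult(1)[OF f g]
    by (simp add: nn_integral_eq_integral flip: ennreal_mult ennreal_power)
  also have "\<dots> \<le> ennreal ((L2_norm M f)\<^sup>2) * ennreal ((L2_norm M g)\<^sup>2)"
    using Cauchy_Schwarz_nn_integral[of "\<lambda>x. ennreal (cmod (f x))" M "\<lambda>x. ennreal (cmod (g x))"]
    unfolding sq[OF f] sq[OF g] by simp
  finally show "(\<integral>x. cmod (f x) * cmod (g x) \<partial>M)\<^sup>2 \<le> (L2_norm M f * L2_norm M g)\<^sup>2"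
    by (simp add: power_mult_distrib ennreal_le_iff flip: ennreal_mult)
qed simp

lemma L2_Cauchy_Schwarz:
  assumes "in_Lp M 2 f" "in_Lp M 2 g"
  shows "cmod (L2_inner M f g) \<le> L2_norm M f * L2_norm M g"
proof -
  have "cmod (L2_inner M f g) \<le> (\<integral>x. cmod (f x * cnj (g x)) \<partial>M)"
    unfolding L2_inner_def by (rule integral_norm_bound)
  also have "\<dots> = (\<integral>x. cmod (f x) * cmod (g x) \<partial>M)"
    by (simp add: norm_mult)
  also have "\<dots> \<le> L2_norm M f * L2_norm M g"
    using assms by (rule L2_Cauchy_Schwarz_cmod)
  finally show ?thesis .
qed

lemma L2_norm_triangle:
  assumes f: "in_Lp M 2 f" and g: "in_Lp M 2 g"
  shows "L2_norm M (\<lambda>x. f x + g x) \<le> L2_norm M f + L2_norm M g"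
proof (rule power2_le_imp_le)
  note [simp] = in_Lp_2_integrable_mult(1)[OF f g]
  have [simp]: "integrable M (\<lambda>x. (cmod (f x))\<^sup>2)" "integrable M (\<lambda>x. (cmod (g x))\<^sup>2)"
    using f g by (auto simp: in_Lp_2_iff)
  have "(L2_norm M (\<lambda>x. f x + g x))\<^sup>2
      \<le> (\<integral>x. (cmod (f x))\<^sup>2 + 2 * (cmod (f x) * cmod (g x)) + (cmod (g x))\<^sup>2 \<partial>M)"
    unfolding L2_norm_square
  proof (rule integral_mono)
    show "integrable M (\<lambda>x. (cmod (f x + g x))\<^sup>2)"
      using in_Lp_2_add[OF f g] by (simp add: in_Lp_2_iff)
    show "(cmod (f x + g x))\<^sup>2 \<le> (cmod (f x))\<^sup>2 + 2 * (cmod (f x) * cmod (g x)) + (cmod (g x))\<^sup>2" for x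
      using power_mono[OF norm_triangle_ineq[of "f x" "g x"], of 2]
      by (simp add: power2_eq_square algebra_simps)
  qed simp
  also have "\<dots> = (L2_norm M f)\<^sup>2 + 2 * (\<integral>x. cmod (f x) * cmod (g x) \<partial>M) + (L2_norm M g)\<^sup>2"
    by (simp add: L2_norm_square)
  also have "\<dots> \<le> (L2_norm M f + L2_norm M g)\<^sup>2"
    using L2_Cauchy_Schwarz_cmod[OF f g] by (simp add: power2_eq_square algebra_simps)
  finally show "(L2_norm M (\<lambda>x. f x + g x))\<^sup>2 \<le> (L2_norm M f + L2_norm M g)\<^sup>2" .
qed simp

lemma L2_inner_add_left:
  "in_Lp M 2 f \<Longrightarrow> in_Lp M 2 g \<Longrightarrow> in_Lp M 2 h \<Longrightarrow>
    L2_inner M (\<lambda>x. f x + g x) h = L2_inner M f h + L2_inner M g h"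
  unfolding L2_inner_def by (simp add: ring_distribs in_Lp_2_integrable_mult)

lemma L2_inner_cnj: "L2_inner M g f = cnj (L2_inner M f g)"
  using Bochner_Integration.integral_cnj[of M "\<lambda>x. f x * cnj (g x)"]
  by (simp add: L2_inner_def mult.commute)

lemma L2_inner_sum_left:
  assumes "finite F" "\<And>i. i \<in> F \<Longrightarrow> in_Lp M 2 (u i)" "in_Lp M 2 h"
  shows "L2_inner M (\<lambda>x. \<Sum>i\<in>F. c i * u i x) h = (\<Sum>i\<in>F. c i * L2_inner M (u i) h)"
proof -
  have "L2_inner M (\<lambda>x. \<Sum>i\<in>F. c i * u i x) h = (\<integral>x. (\<Sum>i\<in>F. c i * (u i x * cnj (h x))) \<partial>M)"
    unfolding L2_inner_def by (simp add: sum_distrib_right mult.assoc)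
  also have "\<dots> = (\<Sum>i\<in>F. c i * L2_inner M (u i) h)"
    using assms unfolding L2_inner_def
    by (subst Bochner_Integration.integral_sum) (auto simp: in_Lp_2_integrable_mult)
  finally show ?thesis .
qed

lemma L2_sum_Cauchy_Schwarz:
  "(\<Sum>i\<in>F. a i * b i) \<le> sqrt (\<Sum>i\<in>F. (a i)\<^sup>2) * sqrt (\<Sum>i\<in>F. (b i :: real)\<^sup>2)"
proof -
  have "(\<Sum>i\<in>F. a i * b i) \<le> sqrt ((\<Sum>i\<in>F. a i * b i)\<^sup>2)"
    by simp
  also have "\<dots> \<le> sqrt ((\<Sum>i\<in>F. (a i)\<^sup>2) * (\<Sum>i\<in>F. (b i)\<^sup>2))"
    by (intro real_sqrt_le_mono Cauchy_Schwarz_ineq_sum)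
  finally show ?thesis by (simp add: real_sqrt_mult)
qed

section \<open>Duality and sup norms\<close>

text \<open>Finiteness of the L^q norm of \<open>h\<close> is a conclusion, so the usual extremal
  test function is cut off where |h| exceeds n. Each truncated integral is bounded by c^q, and
  monotone convergence removes the cut.\<close>

lemma converse_Hoelder:
  fixes q :: real
  assumes q: "2 \<le> q" and h: "in_Lp M 2 h" and c: "0 \<le> c"
    and bound: "\<And>g. in_Lp M 2 g \<Longrightarrow> integrable M (\<lambda>x. cmod (g x) powr (q / (q - 1))) \<Longrightarrow>
      cmod (L2_inner M h g) \<le> c * (\<integral>x. cmod (g x) powr (q / (q - 1)) \<partial>M) powr (1 - 1 / q)"
  shows "Lp_norm M q h \<le> ennreal c"
proof -
  have [measurable]: "h \<in> borel_measurable M" using h by (simp add: in_Lp_2_iff)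
  define H where "H = (\<lambda>n x. cmod (h x) powr q * indicator {x. cmod (h x) \<le> real n} x)"
  have [measurable]: "H n \<in> borel_measurable M" for n unfolding H_def by measurable
  have part: "(\<integral>\<^sup>+x. ennreal (H n x) \<partial>M) \<le> ennreal (c powr q)" for n
  proof -
    \<comment> \<open>The equality case of Hoelder, h |h|^(q - 2): both |g|^q' and h times the
      conjugate of g equal the truncated |h|^q. The cutoff gives |g| \<le> n^(q - 2) |h|, hence
      membership in L^2.\<close>
    define g where "g = (\<lambda>x. h x * complex_of_real (cmod (h x) powr (q - 2) * indicator {x. cmod (h x) \<le> real n} x))"
    have [measurable]: "g \<in> borel_measurable M" unfolding g_def by measurable
    have cg: "cmod (g x) = cmod (h x) powr (q - 1) * indicator {x. cmod (h x) \<le> real n} x" for x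
    proof (cases "h x = 0")
      case False
      then have "cmod (h x) * cmod (h x) powr (q - 2) = cmod (h x) powr (q - 1)"
        by (simp add: powr_mult_base)
      then show ?thesis by (simp add: g_def norm_mult indicator_def)
    qed (simp add: g_def)
    have "in_Lp M 2 g"
    proof (rule in_Lp_2_dominated[OF h, where c = "real n powr (q - 2)"])
      fix x
      show "cmod (g x) \<le> real n powr (q - 2) * cmod (h x)"
        using q powr_mono2[of "q - 2" "cmod (h x)" "real n"]
        by (auto simp: g_def norm_mult indicator_def mult.commute[of "cmod (h x)"] intro!: mult_right_mono)
    qed simp
    have gq: "cmod (g x) powr (q / (q - 1)) = H n x" for x
      using q by (simp add: cg H_def indicator_def powr_powr)
    have hg: "h x * cnj (g x) = complex_of_real (H n x)" for x
    proof (cases "h x = 0")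
      case False
      have "(cmod (h x))\<^sup>2 * cmod (h x) powr (q - 2) = cmod (h x) powr q"
        using False powr_add[of "cmod (h x)" 2 "q - 2"] by simp
      then show ?thesis
        unfolding g_def H_def
        by (simp add: indicator_def complex_norm_square flip: mult.assoc of_real_mult)
          (metis complex_norm_square of_real_mult of_real_power)
    qed (simp add: g_def H_def)
    have intH: "integrable M (H n)"
      using in_Lp_2_integrable_mult(2)[OF h \<open>in_Lp M 2 g\<close>] unfolding hg complex_of_real_integrable_eq .
    define X where "X = (\<integral>x. H n x \<partial>M)"
    have X0: "0 \<le> X" unfolding X_def by (intro Bochner_Integration.integral_nonneg) (simp add: H_def)
    have "L2_inner M h g = complex_of_real X"
      unfolding L2_inner_def hg X_def by simp
    \<comment> \<open>The truncated integral \<open>X\<close> is a finite real, so for X > 0 the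
      power 1 - 1/q can be cancelled, leaving X^(1/q) \<le> c.\<close>
    then have "X \<le> c * X powr (1 - 1 / q)"
      using bound[OF \<open>in_Lp M 2 g\<close>] intH X0 unfolding gq by (simp add: X_def)
    have "X \<le> c powr q"
    proof (cases "X = 0")
      case False
      then have "0 < X" using X0 by simp
      have "X powr (1 - 1 / q) * X powr (1 / q) = X"
        using \<open>0 < X\<close> by (simp flip: powr_add)
      then have "X powr (1 - 1 / q) * X powr (1 / q) \<le> X powr (1 - 1 / q) * c"
        using \<open>X \<le> c * X powr (1 - 1 / q)\<close> by (simp add: mult.commute)
      then have "X powr (1 / q) \<le> c" using \<open>0 < X\<close> by simp
      then have "(X powr (1 / q)) powr q \<le> c powr q"
        using q by (intro powr_mono2) auto
      then show ?thesis using q X0 by (simp add: powr_powr)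
    qed simp
    have "(\<integral>\<^sup>+x. ennreal (H n x) \<partial>M) = ennreal X"
      unfolding X_def by (rule nn_integral_eq_integral[OF intH]) (simp add: H_def)
    then show ?thesis using \<open>X \<le> c powr q\<close> by (simp add: ennreal_leI)
  qed
  have "incseq (\<lambda>n x. ennreal (H n x))"
    unfolding incseq_def le_fun_def H_def
    by (auto simp: indicator_def intro!: ennreal_leI)
  moreover have "(SUP n. ennreal (H n x)) = ennreal (cmod (h x) powr q)" for x
  proof (rule antisym)
    show "(SUP n. ennreal (H n x)) \<le> ennreal (cmod (h x) powr q)"
      by (intro SUP_least ennreal_leI) (simp add: H_def indicator_def)
    obtain n where "cmod (h x) \<le> real n" using real_arch_simple by blast
    then have "ennreal (cmod (h x) powr q) = ennreal (H n x)" by (simp add: H_def)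
    then show "ennreal (cmod (h x) powr q) \<le> (SUP n. ennreal (H n x))"
      by (auto intro: SUP_upper)
  qed
  ultimately have "(\<integral>\<^sup>+x. ennreal (cmod (h x) powr q) \<partial>M) = (SUP n. \<integral>\<^sup>+x. ennreal (H n x) \<partial>M)"
    using nn_integral_monotone_convergence_SUP[of "\<lambda>n x. ennreal (H n x)" M] by simp
  also have "\<dots> \<le> ennreal (c powr q)"
    by (intro SUP_least part)
  finally have le: "(\<integral>\<^sup>+x. ennreal (cmod (h x) powr q) \<partial>M) \<le> ennreal (c powr q)" (is "?Y \<le> _") .
  then have fin: "?Y \<noteq> \<infinity>" by (auto simp: top_unique)
  have "enn2real ?Y \<le> c powr q"
    using enn2real_mono[OF le] by simp
  then have "enn2real ?Y powr (1 / q) \<le> (c powr q) powr (1 / q)"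
    using q by (intro powr_mono2) auto
  also have "\<dots> = c" using q c by (simp add: powr_powr)
  finally show ?thesis
    using fin by (simp add: Lp_norm_def epow_def ennreal_leI)
qed

text \<open>\<open>real_of_ereal\<close> sends both infinities to 0, so the real-valued norm is
  meaningful only once the essential supremum is finite and positive. Membership in L^\<infinity>
  gives finiteness; unit L^2 norm excludes a function vanishing almost everywhere, hence an
  essential supremum of 0 or below.\<close>

lemma Linf_norm_of_unit:
  assumes f: "in_Linf M f" and n: "L2_norm M f = 1"
  shows "AE x in M. cmod (f x) \<le> Linf_norm M f" and "0 < Linf_norm M f"
proof -
  have ae: "AE x in M. ereal (cmod (f x)) \<le> Linf_enorm M f"
    unfolding Linf_enorm_def by (rule esssup_AE)
  have nz: "\<not> (AE x in M. f x = 0)"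
  proof
    assume "AE x in M. f x = 0"
    then have "(\<integral>x. (cmod (f x))\<^sup>2 \<partial>M) = 0"
      by (intro integral_eq_zero_AE) auto
    then show False using n by (simp add: L2_norm_def)
  qed
  have "0 < Linf_enorm M f"
  proof (rule ccontr)
    assume "\<not> 0 < Linf_enorm M f"
    then have "Linf_enorm M f \<le> 0" by simp
    from ae have "AE x in M. f x = 0"
    proof (eventually_elim)
      fix x assume "ereal (cmod (f x)) \<le> Linf_enorm M f"
      with \<open>Linf_enorm M f \<le> 0\<close> have "ereal (cmod (f x)) \<le> 0" by (rule order_trans[rotated])
      then show "f x = 0" by simp
    qed
    with nz show False ..
  qed
  moreover have "Linf_enorm M f < \<infinity>" using f by (simp add: in_Linf_def)
  ultimately have *: "Linf_enorm M f = ereal (Linf_norm M f)" "0 < Linf_norm M f"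
    unfolding Linf_norm_def by (cases "Linf_enorm M f"; simp)+
  show "0 < Linf_norm M f" by fact
  show "AE x in M. cmod (f x) \<le> Linf_norm M f" using ae by (simp add: *)
qed

section \<open>A Paley inequality for bounded Bessel systems\<close>

lemma sum_powr2_le:
  fixes K :: "int set"
  assumes K: "finite K" "\<And>k. k \<in> K \<Longrightarrow> real_of_int k \<le> y" and a: "0 < a"
  shows "(\<Sum>k\<in>K. 2 powr (a * real_of_int k)) \<le> 2 powr (a * y) / (1 - 2 powr (- a))"
proof -
  define m where "m = \<lfloor>y\<rfloor>"
  define \<rho> :: real where "\<rho> = 2 powr (- a)"
  have \<rho>: "0 < \<rho>" "\<rho> < 1" using a by (auto simp: \<rho>_def powr_less_one)
  have km: "k \<le> m" if "k \<in> K" for k using K(2)[OF that] by (simp add: m_def le_floor_iff)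
  \<comment> \<open>Indexing by the distance j = m - k from the top level \<open>m\<close> turns the
    sum into distinct terms of the geometric series with ratio 2^(-a).\<close>
  have "(\<Sum>k\<in>K. 2 powr (a * real_of_int k)) = (\<Sum>k\<in>K. 2 powr (a * real_of_int m) * \<rho> ^ nat (m - k))"
  proof (rule sum.cong)
    fix k assume "k \<in> K"
    then have "real (nat (m - k)) = real_of_int m - real_of_int k" using km by simp
    then show "2 powr (a * real_of_int k) = 2 powr (a * real_of_int m) * \<rho> ^ nat (m - k)"
      using \<rho>(1) by (simp add: \<rho>_def powr_powr algebra_simps flip: powr_realpow powr_add)
  qed simp
  also have "\<dots> = 2 powr (a * real_of_int m) * (\<Sum>j\<in>(\<lambda>k. nat (m - k)) ` K. \<rho> ^ j)"
  proof -
    have "inj_on (\<lambda>k. nat (m - k)) K" using km by (intro inj_onI) (metis diff_ge_0_iff_ge eq_nat_nat_iff diff_left_imp_eq)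
    then show ?thesis by (simp add: sum.reindex sum_distrib_left)
  qed
  also have "\<dots> \<le> 2 powr (a * y) * (1 / (1 - \<rho>))"
  proof (rule mult_mono)
    show "2 powr (a * real_of_int m) \<le> 2 powr (a * y)" using a by (simp add: m_def)
    have "(\<Sum>j\<in>(\<lambda>k. nat (m - k)) ` K. \<rho> ^ j) \<le> (\<Sum>j. \<rho> ^ j)"
      using \<rho> K by (intro sum_le_suminf summable_geometric) auto
    then show "(\<Sum>j\<in>(\<lambda>k. nat (m - k)) ` K. \<rho> ^ j) \<le> 1 / (1 - \<rho>)"
      using \<rho> by (simp add: suminf_geometric)
  qed (use \<rho> in \<open>auto intro!: sum_nonneg\<close>)
  finally show ?thesis by (simp add: \<rho>_def)
qed

lemma sum_powr2_neg_le:
  fixes K :: "int set"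
  assumes K: "finite K" "\<And>k. k \<in> K \<Longrightarrow> y \<le> real_of_int k" and a: "0 < a"
  shows "(\<Sum>k\<in>K. 2 powr (- a * real_of_int k)) \<le> 2 powr (- a * y) / (1 - 2 powr (- a))"
proof -
  have "(\<Sum>k\<in>uminus ` K. 2 powr (a * real_of_int k)) \<le> 2 powr (a * - y) / (1 - 2 powr (- a))"
    using K a by (intro sum_powr2_le) auto
  then show ?thesis by (simp add: sum.reindex)
qed

text \<open>Here x stands for a value of |f| and 2^(-\<gamma> k) for the truncation height at level
  k. The value survives the truncation only for k \<le> -log x / \<gamma>, so the powers of 4 are
  summed up to that level and the top term dominates.\<close>

lemma level_sum_low:
  fixes K :: "int set" and x \<gamma> :: real
  assumes "finite K" "0 \<le> x" "0 < \<gamma>"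
  shows "(\<Sum>k\<in>K. 4 powr real_of_int k * (if x \<le> 2 powr (- \<gamma> * real_of_int k) then x\<^sup>2 else 0))
    \<le> x powr (2 - 2 / \<gamma>) / (1 - 1 / 4)"
proof (cases "x = 0")
  case True
  then show ?thesis using assms by simp
next
  case False
  then have x: "0 < x" using assms by simp
  define K' where "K' = {k\<in>K. x \<le> 2 powr (- \<gamma> * real_of_int k)}"
  define y where "y = - log 2 x / \<gamma>"
  have le: "real_of_int k \<le> y" if "k \<in> K'" for k
  proof -
    have "log 2 x \<le> - \<gamma> * real_of_int k"
      using that x by (simp add: K'_def log_le_iff)
    then show ?thesis using \<open>0 < \<gamma>\<close> by (simp add: y_def field_simps)
  qed
  have four: "4 powr z = (2::real) powr (2 * z)" for z
    by (simp add: powr_powr[symmetric])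
  have "(\<Sum>k\<in>K. 4 powr real_of_int k * (if x \<le> 2 powr (- \<gamma> * real_of_int k) then x\<^sup>2 else 0))
      = x\<^sup>2 * (\<Sum>k\<in>K'. 2 powr (2 * real_of_int k))"
    unfolding K'_def sum.inter_filter[OF assms(1)] sum_distrib_left four
    by (intro sum.cong) auto
  also have "\<dots> \<le> x\<^sup>2 * (2 powr (2 * y) / (1 - 2 powr (- 2)))"
    using assms(1) le by (intro mult_left_mono sum_powr2_le) (auto simp: K'_def)
  also have "2 powr (2 * y) = x powr (- 2 / \<gamma>)"
    using x by (simp add: y_def powr_def log_def)
  also have "x\<^sup>2 * (x powr (- 2 / \<gamma>) / (1 - 2 powr (- 2))) = x powr (2 - 2 / \<gamma>) / (1 - 1 / 4)"
    using x powr_add[of x 2 "- 2 / \<gamma>"] by (simp add: powr_minus)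
  finally show ?thesis .
qed

text \<open>Counterpart for the part above the truncation height: the contributing levels satisfy k
  > -log x / \<gamma>, and the decaying factor 2^(-\<delta> k) makes the lowest of them
  dominate.\<close>

lemma level_sum_high:
  fixes K :: "int set" and x \<gamma> :: real
  assumes "finite K" "0 \<le> x" "0 < \<gamma>" "0 < \<delta>"
  shows "(\<Sum>k\<in>K. 2 powr (- \<delta> * real_of_int k) * (if x \<le> 2 powr (- \<gamma> * real_of_int k) then 0 else x))
    \<le> x powr (1 + \<delta> / \<gamma>) / (1 - 2 powr (- \<delta>))"
proof (cases "x = 0")
  case True
  then show ?thesis using assms by simp
next
  case False
  then have x: "0 < x" using assms by simp
  define K' where "K' = {k\<in>K. \<not> x \<le> 2 powr (- \<gamma> * real_of_int k)}"
  define y where "y = - log 2 x / \<gamma>"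
  have le: "y \<le> real_of_int k" if "k \<in> K'" for k
  proof -
    have "- \<gamma> * real_of_int k \<le> log 2 x"
      using that x by (simp add: K'_def le_log_iff)
    then show ?thesis using \<open>0 < \<gamma>\<close> by (simp add: y_def field_simps)
  qed
  have "(\<Sum>k\<in>K. 2 powr (- \<delta> * real_of_int k) * (if x \<le> 2 powr (- \<gamma> * real_of_int k) then 0 else x))
      = x * (\<Sum>k\<in>K'. 2 powr (- \<delta> * real_of_int k))"
    unfolding K'_def sum.inter_filter[OF assms(1)] sum_distrib_left
    by (intro sum.cong) auto
  also have "\<dots> \<le> x * (2 powr (- \<delta> * y) / (1 - 2 powr (- \<delta>)))"
    using assms le x by (intro mult_left_mono sum_powr2_neg_le) (auto simp: K'_def)
  also have "2 powr (- \<delta> * y) = x powr (\<delta> / \<gamma>)"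
    using x by (simp add: y_def powr_def log_def)
  also have "x * (x powr (\<delta> / \<gamma>) / (1 - 2 powr (- \<delta>))) = x powr (1 + \<delta> / \<gamma>) / (1 - 2 powr (- \<delta>))"
    using x powr_add[of x 1 "\<delta> / \<gamma>"] by simp
  finally show ?thesis .
qed

text \<open>The 8 is 4 times 2: squaring the weight on a dyadic level costs 4, and splitting a
  squared coefficient into two parts costs 2. The summands inside come from the geometric series of
  ratio 1/4 (low part, with the Bessel bound \<open>B\<close>) and of ratio 2^(-\<delta>), \<delta>
  = 2(p - 1)/(2 - p) (high part). The second one blows up as p tends to 1.\<close>

definition Paley_const :: "real \<Rightarrow> real \<Rightarrow> real" where
  "Paley_const p B = 8 * (B * (4 / 3) + 1 / (1 - 2 powr (- (2 * (p - 1) / (2 - p)))))"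

text \<open>At p = 2 both divisions by zero in the constant return 0, and the lemma still holds.\<close>
lemma Paley_const_ge:
  assumes "1 < p" "p \<le> 2" "0 \<le> B"
  shows "B \<le> Paley_const p B"
proof -
  have "0 \<le> 2 * (p - 1) / (2 - p)"
    using assms by simp
  then have "2 powr (- (2 * (p - 1) / (2 - p))) \<le> 1"
    using powr_mono[of "- (2 * (p - 1) / (2 - p))" 0 2] by simp
  then have "0 \<le> 1 / (1 - 2 powr (- (2 * (p - 1) / (2 - p))))"
    by simp
  moreover have "B \<le> 8 * (B * (4 / 3) + x)" if "0 \<le> x" for x
    using that assms(3) by simp
  ultimately show ?thesis
    unfolding Paley_const_def by blast
qed

text \<open>On the set where |f| > t one has |f| \<le> |f|^2 / t, so the high part of an L^2
  function is in L^1, even on a space of infinite measure.\<close>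

lemma truncated_part_integrable:
  assumes f: "in_Lp M 2 f" and t: "0 < t"
  shows "integrable M (\<lambda>x. if cmod (f x) \<le> t then (cmod (f x))\<^sup>2 else 0)"
    and "integrable M (\<lambda>x. if cmod (f x) \<le> t then 0 else cmod (f x))"
proof -
  have [measurable]: "f \<in> borel_measurable M" using f by (simp add: in_Lp_2_iff)
  have i: "integrable M (\<lambda>x. (cmod (f x))\<^sup>2)" using f by (simp add: in_Lp_2_iff)
  show "integrable M (\<lambda>x. if cmod (f x) \<le> t then (cmod (f x))\<^sup>2 else 0)"
    by (rule Bochner_Integration.integrable_bound[OF i]) auto
  have i': "integrable M (\<lambda>x. (1 / t) * (cmod (f x))\<^sup>2)" using i by simp
  have *: "norm (if y \<le> t then 0 else y) \<le> norm ((1 / t) * y\<^sup>2)" if "0 \<le> y" for y :: real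
    using t that mult_right_mono[of t y y] by (simp add: field_simps power2_eq_square)
  show "integrable M (\<lambda>x. if cmod (f x) \<le> t then 0 else cmod (f x))"
    by (rule Bochner_Integration.integrable_bound[OF i' _ AE_I2[OF *]]) auto
qed

text \<open>Isolates the two facts that the Paley inequality uses, a bound from L^2 to
  square-summable coefficients and a pointwise bound whose square is \<open>w\<close>. It is
  instantiated for \<open>u\<close> and for \<open>v\<close>, with different Bessel bounds.\<close>

locale bessel_system =
  fixes M :: "'a measure" and I :: "'i set" and e :: "'i \<Rightarrow> 'a \<Rightarrow> complex"
    and w :: "'i \<Rightarrow> real" and B :: real
  assumes e_L2: "\<And>\<xi>. \<xi> \<in> I \<Longrightarrow> in_Lp M 2 (e \<xi>)"
    and e_bound: "\<And>\<xi>. \<xi> \<in> I \<Longrightarrow> AE x in M. cmod (e \<xi> x) \<le> sqrt (w \<xi>)"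
    and w_pos: "\<And>\<xi>. \<xi> \<in> I \<Longrightarrow> 0 < w \<xi>"
    and B_nonneg: "0 \<le> B"
    and bessel: "\<And>F f. finite F \<Longrightarrow> F \<subseteq> I \<Longrightarrow> in_Lp M 2 f \<Longrightarrow>
      (\<Sum>\<xi>\<in>F. (cmod (L2_inner M f (e \<xi>)))\<^sup>2) \<le> B * (L2_norm M f)\<^sup>2"
begin

text \<open>The coefficients of the low part are controlled in L^2 by Bessel; each coefficient of
  the high part is at most sqrt w times its L^1 norm. The inequality (x + y)^2 \<le> 2 x^2 + 2 y^2
  combines the two.\<close>

lemma bessel_truncation:
  assumes F: "finite F" "F \<subseteq> I" and f: "in_Lp M 2 f" and t: "0 < t"
  shows "(\<Sum>\<xi>\<in>F. (cmod (L2_inner M f (e \<xi>)))\<^sup>2)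
    \<le> 2 * (B * (\<integral>x. (if cmod (f x) \<le> t then (cmod (f x))\<^sup>2 else 0) \<partial>M)
         + (\<Sum>\<xi>\<in>F. w \<xi>) * (\<integral>x. (if cmod (f x) \<le> t then 0 else cmod (f x)) \<partial>M)\<^sup>2)"
proof -
  have [measurable]: "f \<in> borel_measurable M" using f by (simp add: in_Lp_2_iff)
  define lo where "lo = (\<lambda>x. if cmod (f x) \<le> t then f x else 0)"
  define hi where "hi = (\<lambda>x. if cmod (f x) \<le> t then 0 else f x)"
  define J where "J = (\<integral>x. (if cmod (f x) \<le> t then 0 else cmod (f x)) \<partial>M)"
  have [measurable]: "lo \<in> borel_measurable M" "hi \<in> borel_measurable M"
    unfolding lo_def hi_def by measurable
  have lo: "in_Lp M 2 lo"
    by (rule in_Lp_2_dominated[OF f, where c = 1]) (auto simp: lo_def)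
  have hi: "in_Lp M 2 hi"
    by (rule in_Lp_2_dominated[OF f, where c = 1]) (auto simp: hi_def)
  have "(\<lambda>x. lo x + hi x) = f" by (auto simp: lo_def hi_def)
  have hi_coeff: "(cmod (L2_inner M hi (e \<xi>)))\<^sup>2 \<le> w \<xi> * J\<^sup>2" if "\<xi> \<in> I" for \<xi>
  proof -
    have "cmod (L2_inner M hi (e \<xi>)) \<le> (\<integral>x. cmod (hi x * cnj (e \<xi> x)) \<partial>M)"
      unfolding L2_inner_def by (rule integral_norm_bound)
    also have "\<dots> \<le> (\<integral>x. sqrt (w \<xi>) * (if cmod (f x) \<le> t then 0 else cmod (f x)) \<partial>M)"
    proof (rule integral_mono_AE)
      show "AE x in M. cmod (hi x * cnj (e \<xi> x)) \<le> sqrt (w \<xi>) * (if cmod (f x) \<le> t then 0 else cmod (f x))"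
        using e_bound[OF that]
        by eventually_elim (auto simp: hi_def norm_mult mult.commute[of "sqrt (w \<xi>)"] intro: mult_left_mono)
    qed (use integrable_norm[OF in_Lp_2_integrable_mult(2)[OF hi e_L2[OF that]]]
        truncated_part_integrable(2)[OF f t] in auto)
    also have "\<dots> = sqrt (w \<xi>) * J" by (simp add: J_def)
    finally have "(cmod (L2_inner M hi (e \<xi>)))\<^sup>2 \<le> (sqrt (w \<xi>) * J)\<^sup>2"
      by (intro power_mono) auto
    then show ?thesis using w_pos[OF that] by (simp add: power_mult_distrib)
  qed
  have "(\<Sum>\<xi>\<in>F. (cmod (L2_inner M f (e \<xi>)))\<^sup>2)
      \<le> (\<Sum>\<xi>\<in>F. 2 * (cmod (L2_inner M lo (e \<xi>)))\<^sup>2 + 2 * (w \<xi> * J\<^sup>2))"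
  proof (rule sum_mono)
    fix \<xi> assume "\<xi> \<in> F"
    then have \<xi>: "\<xi> \<in> I" using F by auto
    have "L2_inner M f (e \<xi>) = L2_inner M lo (e \<xi>) + L2_inner M hi (e \<xi>)"
      using L2_inner_add_left[OF lo hi e_L2[OF \<xi>]] \<open>(\<lambda>x. lo x + hi x) = f\<close> by simp
    then have "(cmod (L2_inner M f (e \<xi>)))\<^sup>2 \<le> (cmod (L2_inner M lo (e \<xi>)) + cmod (L2_inner M hi (e \<xi>)))\<^sup>2"
      by (simp add: power_mono norm_triangle_ineq)
    also have "\<dots> \<le> 2 * (cmod (L2_inner M lo (e \<xi>)))\<^sup>2 + 2 * (cmod (L2_inner M hi (e \<xi>)))\<^sup>2"
      using zero_le_power2[of "cmod (L2_inner M lo (e \<xi>)) - cmod (L2_inner M hi (e \<xi>))"]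
      by (simp add: power2_eq_square algebra_simps)
    finally show "(cmod (L2_inner M f (e \<xi>)))\<^sup>2 \<le> 2 * (cmod (L2_inner M lo (e \<xi>)))\<^sup>2 + 2 * (w \<xi> * J\<^sup>2)"
      using hi_coeff[OF \<xi>] by linarith
  qed
  also have "\<dots> = 2 * ((\<Sum>\<xi>\<in>F. (cmod (L2_inner M lo (e \<xi>)))\<^sup>2) + (\<Sum>\<xi>\<in>F. w \<xi>) * J\<^sup>2)"
    by (simp add: sum.distrib sum_distrib_left sum_distrib_right distrib_left)
  also have "\<dots> \<le> 2 * (B * (L2_norm M lo)\<^sup>2 + (\<Sum>\<xi>\<in>F. w \<xi>) * J\<^sup>2)"
    using bessel[OF F lo] by simp
  also have "(L2_norm M lo)\<^sup>2 = (\<integral>x. (if cmod (f x) \<le> t then (cmod (f x))\<^sup>2 else 0) \<partial>M)"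
    unfolding L2_norm_square by (intro Bochner_Integration.integral_cong) (auto simp: lo_def)
  finally show ?thesis by (simp add: J_def)
qed

lemma Paley_normalized:
  assumes p: "1 < p" "p < 2" and F: "finite F" "F \<subseteq> I"
    and f: "in_Lp M 2 f" "integrable M (\<lambda>x. cmod (f x) powr p)" "(\<integral>x. cmod (f x) powr p \<partial>M) \<le> 1"
    and \<phi>: "\<And>\<xi>. \<xi> \<in> F \<Longrightarrow> 0 < \<phi> \<xi>"
      "\<And>s. 0 < s \<Longrightarrow> s * (\<Sum>\<xi> | \<xi> \<in> F \<and> s \<le> \<phi> \<xi>. w \<xi>) powr (1 / p - 1 / 2) \<le> 1"
  shows "(\<Sum>\<xi>\<in>F. (cmod (L2_inner M f (e \<xi>)))\<^sup>2 * (\<phi> \<xi>)\<^sup>2)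
    \<le> Paley_const p B"
proof -
  have [measurable]: "f \<in> borel_measurable M" using f by (simp add: in_Lp_2_iff)
  txt \<open>Dyadic level sets of the weight, with f truncated at a height t j that decreases with the
    level j: the part below t j is controlled by the Bessel inequality, the part above by the
    sup bound on the system. The exponent of t is the one that makes both geometric sums over
    the levels reproduce the p-th power of f.\<close>
  define \<gamma> where "\<gamma> = 2 / (2 - p)"
  define \<delta> where "\<delta> = 2 * (p - 1) / (2 - p)"
  define \<alpha> where "\<alpha> = 1 / p - 1 / 2"
  have pos: "0 < \<gamma>" "0 < \<delta>" "0 < \<alpha>"
    using p by (auto simp: \<gamma>_def \<delta>_def \<alpha>_def divide_simps)
  \<comment> \<open>The first two make the low and high level sums return |f|^p. The third is the
    growth rate of the L^1 norm of the high part in \<open>Hi_le\<close>. The fourth says that 4^j,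
    the weight bound 2^(-j / \<alpha>) and that growth combine to the decay 2^(-\<delta> j) required
    by \<open>level_sum_high\<close>.\<close>
  have expo: "2 - 2 / \<gamma> = p" "1 + \<delta> / \<gamma> = p" "\<gamma> * (p - 1) = \<delta>" "2 - 1 / \<alpha> + \<delta> = - \<delta>"
    using p zero_less_power2[of "p - 2"]
    by (auto simp: \<gamma>_def \<delta>_def \<alpha>_def divide_simps algebra_simps power2_eq_square)
  define k where "k = (\<lambda>\<xi>. \<lfloor>log 2 (\<phi> \<xi>)\<rfloor>)"
  define K where "K = k ` F"
  have K: "finite K" using F by (simp add: K_def)
  define t where "t = (\<lambda>j. 2 powr (- \<gamma> * real_of_int j))"
  have t: "0 < t j" for j by (simp add: t_def)
  define Lo where "Lo = (\<lambda>j x. if cmod (f x) \<le> t j then (cmod (f x))\<^sup>2 else 0)"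
  define Hi where "Hi = (\<lambda>j x. if cmod (f x) \<le> t j then 0 else cmod (f x))"
  have int: "integrable M (Lo j)" "integrable M (Hi j)" for j
    using truncated_part_integrable[OF f(1) t[of j]] unfolding Lo_def Hi_def by auto
  have four: "4 powr z = (2::real) powr (2 * z)" for z
    by (simp add: powr_powr[symmetric])
  have Hi_nonneg: "0 \<le> (\<integral>x. Hi j x \<partial>M)" for j
    by (intro Bochner_Integration.integral_nonneg) (simp add: Hi_def)
  have Hi_le: "(\<integral>x. Hi j x \<partial>M) \<le> 2 powr (\<delta> * real_of_int j)" for j
  proof -
    have "Hi j x \<le> t j powr (1 - p) * cmod (f x) powr p" for x
    proof (cases "cmod (f x) \<le> t j")
      case False
      then have fx: "0 < cmod (f x)" using t[of j] by linarith
      have "cmod (f x) = cmod (f x) powr (1 - p) * cmod (f x) powr p"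
        using fx by (simp flip: powr_add)
      \<comment> \<open>The exponent 1 - p is negative, so |f| > t j makes |f|^(1 - p) at most (t
        j)^(1 - p).\<close>
      also have "\<dots> \<le> t j powr (1 - p) * cmod (f x) powr p"
        using False p t[of j] by (intro mult_right_mono powr_mono2') auto
      finally show ?thesis using False by (simp add: Hi_def)
    qed (simp add: Hi_def)
    then have "(\<integral>x. Hi j x \<partial>M) \<le> (\<integral>x. t j powr (1 - p) * cmod (f x) powr p \<partial>M)"
      using f int by (intro integral_mono) auto
    also have "\<dots> \<le> t j powr (1 - p) * 1"
      using f(3) by (simp del: mult_1_right) (intro mult_left_mono, auto)
    also have "\<dots> = 2 powr ((\<gamma> * (p - 1)) * real_of_int j)"
      by (simp add: t_def powr_powr algebra_simps)
    finally show ?thesis by (simp add: expo)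
  qed
  have level: "(\<Sum>\<xi> | \<xi> \<in> F \<and> k \<xi> = j. (cmod (L2_inner M f (e \<xi>)))\<^sup>2 * (\<phi> \<xi>)\<^sup>2)
      \<le> 8 * (B * (4 powr real_of_int j * (\<integral>x. Lo j x \<partial>M)) + 2 powr (- \<delta> * real_of_int j) * (\<integral>x. Hi j x \<partial>M))" for j
  proof -
    define G where "G = {\<xi>. \<xi> \<in> F \<and> k \<xi> = j}"
    have G: "finite G" "G \<subseteq> I" using F by (auto simp: G_def)
    have \<phi>G: "2 powr real_of_int j \<le> \<phi> \<xi>" "(\<phi> \<xi>)\<^sup>2 \<le> 4 * 4 powr real_of_int j" if "\<xi> \<in> G" for \<xi>
    proof -
      have "0 < \<phi> \<xi>" "k \<xi> = j" using that \<phi> by (auto simp: G_def)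
      then have j: "real_of_int j \<le> log 2 (\<phi> \<xi>)" "log 2 (\<phi> \<xi>) \<le> real_of_int j + 1"
        unfolding k_def by linarith+
      then show "2 powr real_of_int j \<le> \<phi> \<xi>"
        using \<open>0 < \<phi> \<xi>\<close> by (simp add: le_log_iff)
      have "\<phi> \<xi> \<le> 2 powr (real_of_int j + 1)"
        using j \<open>0 < \<phi> \<xi>\<close> by (simp add: log_le_iff)
      then have "(\<phi> \<xi>)\<^sup>2 \<le> (2 powr (real_of_int j + 1))\<^sup>2"
        using \<open>0 < \<phi> \<xi>\<close> by (intro power_mono) auto
      also have "\<dots> = 4 * 4 powr real_of_int j"
        by (simp add: four powr_add power_mult_distrib powr_power)
      finally show "(\<phi> \<xi>)\<^sup>2 \<le> 4 * 4 powr real_of_int j" .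
    qed
    define W where "W = (\<Sum>\<xi>\<in>G. w \<xi>)"
    define V where "V = (\<Sum>\<xi> | \<xi> \<in> F \<and> 2 powr real_of_int j \<le> \<phi> \<xi>. w \<xi>)"
    have V0: "0 \<le> V" unfolding V_def using F w_pos by (intro sum_nonneg) (auto intro: less_imp_le)
    have "W \<le> V"
      unfolding W_def V_def using F w_pos \<phi>G(1)
      by (intro sum_mono2) (auto simp: G_def intro: less_imp_le)
    \<comment> \<open>The weak-type hypothesis at s = 2^j bounds V^\<alpha> by 2^(-j). Solving for
      \<open>V\<close> needs \<alpha> > 0, that is p < 2.\<close>
    also have "V = (V powr \<alpha>) powr (1 / \<alpha>)"
      using pos V0 by (simp add: powr_powr)
    also have "\<dots> \<le> (2 powr (- real_of_int j)) powr (1 / \<alpha>)"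
    proof (rule powr_mono2)
      have "2 powr real_of_int j * V powr \<alpha> \<le> 1"
        using \<phi>(2)[of "2 powr real_of_int j"] by (simp add: V_def \<alpha>_def)
      then show "V powr \<alpha> \<le> 2 powr (- real_of_int j)"
        by (simp add: powr_minus field_simps)
    qed (use pos in auto)
    finally have W: "W \<le> 2 powr (- real_of_int j / \<alpha>)" by (simp add: powr_powr)
    have "(\<Sum>\<xi>\<in>G. (cmod (L2_inner M f (e \<xi>)))\<^sup>2 * (\<phi> \<xi>)\<^sup>2)
        \<le> (\<Sum>\<xi>\<in>G. (cmod (L2_inner M f (e \<xi>)))\<^sup>2 * (4 * 4 powr real_of_int j))"
      using \<phi>G(2) by (intro sum_mono mult_left_mono) auto
    also have "\<dots> = 4 * 4 powr real_of_int j * (\<Sum>\<xi>\<in>G. (cmod (L2_inner M f (e \<xi>)))\<^sup>2)"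
      by (simp add: sum_distrib_left mult_ac)
    also have "\<dots> \<le> 4 * 4 powr real_of_int j * (2 * (B * (\<integral>x. Lo j x \<partial>M) + W * (\<integral>x. Hi j x \<partial>M)\<^sup>2))"
      unfolding W_def Lo_def Hi_def by (intro mult_left_mono bessel_truncation[OF G f(1) t]) simp
    also have "\<dots> = 8 * (B * (4 powr real_of_int j * (\<integral>x. Lo j x \<partial>M)) + 4 powr real_of_int j * (W * (\<integral>x. Hi j x \<partial>M)\<^sup>2))"
      by (simp add: algebra_simps)
    \<comment> \<open>Only one of the two factors of the squared integral is replaced by its bound.
      The other stays, so that the estimate is linear in the high part and the sum over levels can
      be moved under the integral.\<close>
    also have "4 powr real_of_int j * (W * (\<integral>x. Hi j x \<partial>M)\<^sup>2) \<le>
        4 powr real_of_int j * (2 powr (- real_of_int j / \<alpha>) * (2 powr (\<delta> * real_of_int j) * (\<integral>x. Hi j x \<partial>M)))"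
      unfolding power2_eq_square using W Hi_le Hi_nonneg
      by (intro mult_left_mono mult_mono mult_right_mono mult_nonneg_nonneg) auto
    also have "\<dots> = 2 powr ((2 - 1 / \<alpha> + \<delta>) * real_of_int j) * (\<integral>x. Hi j x \<partial>M)"
      by (simp add: four algebra_simps flip: powr_add)
    finally show ?thesis by (simp add: expo G_def)
  qed
  have "(\<Sum>\<xi>\<in>F. (cmod (L2_inner M f (e \<xi>)))\<^sup>2 * (\<phi> \<xi>)\<^sup>2)
      = (\<Sum>j\<in>K. \<Sum>\<xi> | \<xi> \<in> F \<and> k \<xi> = j. (cmod (L2_inner M f (e \<xi>)))\<^sup>2 * (\<phi> \<xi>)\<^sup>2)"
    unfolding K_def by (rule sum.image_gen[OF F(1)])
  also have "\<dots> \<le> (\<Sum>j\<in>K. 8 * (B * (4 powr real_of_int j * (\<integral>x. Lo j x \<partial>M))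
      + 2 powr (- \<delta> * real_of_int j) * (\<integral>x. Hi j x \<partial>M)))"
    by (intro sum_mono level)
  also have "\<dots> = 8 * (B * (\<Sum>j\<in>K. 4 powr real_of_int j * (\<integral>x. Lo j x \<partial>M))
      + (\<Sum>j\<in>K. 2 powr (- \<delta> * real_of_int j) * (\<integral>x. Hi j x \<partial>M)))"
    by (simp add: sum.distrib sum_distrib_left distrib_left)
  also have "(\<Sum>j\<in>K. 4 powr real_of_int j * (\<integral>x. Lo j x \<partial>M)) \<le> 4 / 3"
  proof -
    \<comment> \<open>The finite sum over levels goes under the integral, where
      \<open>level_sum_low\<close> applies at each point to the value |f(x)|.\<close>
    have "(\<Sum>j\<in>K. 4 powr real_of_int j * (\<integral>x. Lo j x \<partial>M)) = (\<integral>x. (\<Sum>j\<in>K. 4 powr real_of_int j * Lo j x) \<partial>M)"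
      using int by (subst Bochner_Integration.integral_sum) auto
    also have "\<dots> \<le> (\<integral>x. 4 / 3 * cmod (f x) powr p \<partial>M)"
    proof (rule integral_mono)
      fix x show "(\<Sum>j\<in>K. 4 powr real_of_int j * Lo j x) \<le> 4 / 3 * cmod (f x) powr p"
        using level_sum_low[OF K _ pos(1), of "cmod (f x)"] by (simp add: Lo_def t_def expo)
    qed (use int f in auto)
    also have "\<dots> \<le> 4 / 3" using f(3) by simp
    finally show ?thesis .
  qed
  also have "(\<Sum>j\<in>K. 2 powr (- \<delta> * real_of_int j) * (\<integral>x. Hi j x \<partial>M)) \<le> 1 / (1 - 2 powr (- \<delta>))"
  proof -
    have \<delta>1: "0 < 1 - 2 powr (- \<delta>)" using pos by (simp add: powr_less_one)
    have "(\<Sum>j\<in>K. 2 powr (- \<delta> * real_of_int j) * (\<integral>x. Hi j x \<partial>M)) = (\<integral>x. (\<Sum>j\<in>K. 2 powr (- \<delta> * real_of_int j) * Hi j x) \<partial>M)"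
      using int by (subst Bochner_Integration.integral_sum) auto
    also have "\<dots> \<le> (\<integral>x. 1 / (1 - 2 powr (- \<delta>)) * cmod (f x) powr p \<partial>M)"
    proof (rule integral_mono)
      fix x show "(\<Sum>j\<in>K. 2 powr (- \<delta> * real_of_int j) * Hi j x) \<le> 1 / (1 - 2 powr (- \<delta>)) * cmod (f x) powr p"
        using level_sum_high[OF K _ pos(1,2), of "cmod (f x)"] by (simp add: Hi_def t_def expo)
    qed (use int f in auto)
    also have "\<dots> = 1 / (1 - 2 powr (- \<delta>)) * (\<integral>x. cmod (f x) powr p \<partial>M)" by simp
    also have "\<dots> \<le> 1 / (1 - 2 powr (- \<delta>)) * 1"
      using f(3) \<delta>1 by (intro mult_left_mono) auto
    finally show ?thesis by simp
  qed
  finally show ?thesis using B_nonneg by (simp add: Paley_const_def \<delta>_def mult_left_mono)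
qed

text \<open>For p < 2 both sides scale, so dividing \<open>f\<close> by its L^p norm and \<phi> by
  \<open>K\<close> reduces to the normalized case. For p = 2 the weak-type condition degenerates to
  a uniform bound on \<phi> and Bessel alone suffices.\<close>

lemma Paley:
  assumes p: "1 < p" "p \<le> 2" and F: "finite F" "F \<subseteq> I"
    and f: "in_Lp M 2 f" "integrable M (\<lambda>x. cmod (f x) powr p)"
    and \<phi>: "\<And>\<xi>. \<xi> \<in> F \<Longrightarrow> 0 < \<phi> \<xi>" and K: "0 < K"
    and le: "\<And>s. 0 < s \<Longrightarrow> s * (\<Sum>\<xi> | \<xi> \<in> F \<and> s \<le> \<phi> \<xi>. w \<xi>) powr (1 / p - 1 / 2) \<le> K"
  shows "(\<Sum>\<xi>\<in>F. (cmod (L2_inner M f (e \<xi>)))\<^sup>2 * (\<phi> \<xi>)\<^sup>2)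
    \<le> Paley_const p B * K\<^sup>2 * (\<integral>x. cmod (f x) powr p \<partial>M) powr (2 / p)"
proof (cases "p = 2")
  case True
  have \<phi>K: "\<phi> \<xi> \<le> K" if "\<xi> \<in> F" for \<xi>
  proof -
    \<comment> \<open>The exponent 1/p - 1/2 is 0 here, and \<open>powr\<close> gives 0 for 0 to the
      power 0. Positivity of the sum, which contains the index \<xi> itself, makes the power equal
      to 1.\<close>
    have "0 < (\<Sum>\<eta> | \<eta> \<in> F \<and> \<phi> \<xi> \<le> \<phi> \<eta>. w \<eta>)"
      using F that w_pos by (intro sum_pos) auto
    then show ?thesis using le[OF \<phi>[OF that]] True by simp
  qed
  have "(\<Sum>\<xi>\<in>F. (cmod (L2_inner M f (e \<xi>)))\<^sup>2 * (\<phi> \<xi>)\<^sup>2) \<le> (\<Sum>\<xi>\<in>F. (cmod (L2_inner M f (e \<xi>)))\<^sup>2 * K\<^sup>2)"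
    using \<phi>K \<phi> by (intro sum_mono mult_left_mono power_mono) (auto intro: less_imp_le)
  also have "\<dots> = K\<^sup>2 * (\<Sum>\<xi>\<in>F. (cmod (L2_inner M f (e \<xi>)))\<^sup>2)"
    by (simp add: sum_distrib_left mult.commute)
  also have "\<dots> \<le> K\<^sup>2 * (B * (L2_norm M f)\<^sup>2)"
    by (intro mult_left_mono bessel F f) simp
  also have "\<dots> \<le> K\<^sup>2 * (Paley_const p B * (L2_norm M f)\<^sup>2)"
    by (intro mult_left_mono mult_right_mono Paley_const_ge p B_nonneg) auto
  finally show ?thesis
    using True by (simp add: L2_norm_square mult_ac)
next
  case False
  then have "p < 2" using p by simp
  define C where "C = Paley_const p B"
  have C: "0 \<le> C" using Paley_const_ge[OF p B_nonneg] B_nonneg by (simp add: C_def)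
  have [measurable]: "f \<in> borel_measurable M" using f by (simp add: in_Lp_2_iff)
  define N where "N = (\<integral>x. cmod (f x) powr p \<partial>M)"
  have "0 \<le> N" unfolding N_def by (intro Bochner_Integration.integral_nonneg) simp
  have "(\<Sum>\<xi>\<in>F. (cmod (L2_inner M f (e \<xi>)))\<^sup>2 * (\<phi> \<xi>)\<^sup>2) \<le> C * K\<^sup>2 * N powr (2 / p)"
  proof (cases "N = 0")
    case True
    then have "AE x in M. cmod (f x) powr p = 0"
      using f(2) unfolding N_def by (subst (asm) integral_nonneg_eq_0_iff_AE) auto
    then have "L2_inner M f g = 0" for g
      unfolding L2_inner_def by (intro integral_eq_zero_AE) (auto elim: eventually_mono)
    then show ?thesis using C by simp
  next
    case False
    then have "0 < N" using \<open>0 \<le> N\<close> by simp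
    define n where "n = N powr (1 / p)"
    have n: "0 < n" using \<open>0 < N\<close> by (simp add: n_def)
    define g where "g = (\<lambda>x. complex_of_real (1 / n) * f x)"
    have g: "in_Lp M 2 g" unfolding g_def using f(1) by (rule in_Lp_2_cmult)
    have gp: "cmod (g x) powr p = 1 / N * cmod (f x) powr p" for x
      using n p \<open>0 < N\<close> by (simp add: g_def norm_mult norm_divide powr_divide n_def powr_powr)
    have ginner: "L2_inner M f h = n * L2_inner M g h" for h
      using n unfolding L2_inner_def g_def by (simp add: mult.assoc)
    have "(\<Sum>\<xi>\<in>F. (cmod (L2_inner M g (e \<xi>)))\<^sup>2 * (\<phi> \<xi> / K)\<^sup>2) \<le> C"
      unfolding C_def
    proof (rule Paley_normalized[OF p(1) \<open>p < 2\<close> F g])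
      show "integrable M (\<lambda>x. cmod (g x) powr p)" "(\<integral>x. cmod (g x) powr p \<partial>M) \<le> 1"
        using f(2) \<open>0 < N\<close> unfolding gp by (auto simp flip: N_def)
      show "0 < \<phi> \<xi> / K" if "\<xi> \<in> F" for \<xi> using that \<phi> K by simp
      show "s * (\<Sum>\<xi> | \<xi> \<in> F \<and> s \<le> \<phi> \<xi> / K. w \<xi>) powr (1 / p - 1 / 2) \<le> 1" if "0 < s" for s
        using le[of "s * K"] that K by (simp add: pos_le_divide_eq mult_ac)
    qed
    then have "n\<^sup>2 * K\<^sup>2 * (\<Sum>\<xi>\<in>F. (cmod (L2_inner M g (e \<xi>)))\<^sup>2 * (\<phi> \<xi> / K)\<^sup>2) \<le> n\<^sup>2 * K\<^sup>2 * C"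
      by (intro mult_left_mono) auto
    moreover have "n\<^sup>2 * K\<^sup>2 * (\<Sum>\<xi>\<in>F. (cmod (L2_inner M g (e \<xi>)))\<^sup>2 * (\<phi> \<xi> / K)\<^sup>2)
        = (\<Sum>\<xi>\<in>F. (cmod (L2_inner M f (e \<xi>)))\<^sup>2 * (\<phi> \<xi>)\<^sup>2)"
      unfolding sum_distrib_left using K n
      by (intro sum.cong) (auto simp: ginner norm_mult power_mult_distrib power_divide)
    moreover have "n\<^sup>2 = N powr (2 / p)"
      using \<open>0 < N\<close> by (simp add: n_def powr_power)
    ultimately show ?thesis by (simp add: mult_ac)
  qed
  then show ?thesis by (simp add: C_def N_def)
qed

end

section \<open>Multipliers for biorthogonal Riesz bases\<close>

text \<open>For \<theta> > 0 the condition s \<le> \<tau>^\<theta> is s^(1 / \<theta>) \<le> \<tau>,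
  so the claim is the hypothesis at s^(1 / \<theta>) raised to the power \<theta>.\<close>

lemma weak_type_powr:
  fixes \<tau> w :: "'i \<Rightarrow> real"
  assumes F: "finite F" "\<And>\<xi>. \<xi> \<in> F \<Longrightarrow> 0 < \<tau> \<xi>" "\<And>\<xi>. \<xi> \<in> F \<Longrightarrow> 0 \<le> w \<xi>"
    and S: "0 < S" "\<And>s. 0 < s \<Longrightarrow> s * (\<Sum>\<xi> | \<xi> \<in> F \<and> s \<le> \<tau> \<xi>. w \<xi>) powr \<alpha> \<le> S"
    and \<theta>: "0 \<le> \<theta>" and s: "0 < s"
  shows "s * (\<Sum>\<xi> | \<xi> \<in> F \<and> s \<le> \<tau> \<xi> powr \<theta>. w \<xi>) powr (\<theta> * \<alpha>) \<le> S powr \<theta>"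
proof (cases "\<theta> = 0")
  \<comment> \<open>With \<theta> = 0 the function is constantly 1: no level above 1 is reached, and
    for s \<le> 1 the power with exponent 0 is at most 1.\<close>
  case True
  show ?thesis
  proof (cases "s \<le> 1")
    case False
    then have "{\<xi>. \<xi> \<in> F \<and> s \<le> \<tau> \<xi> powr \<theta>} = {}"
      using F True by fastforce
    then show ?thesis using S by (simp only: sum.empty) simp
  qed (use True S s in auto)
next
  case False
  then have "0 < \<theta>" using \<theta> by simp
  define s' where "s' = s powr (1 / \<theta>)"
  have s': "0 < s'" "s' powr \<theta> = s" using s \<open>0 < \<theta>\<close> by (auto simp: s'_def powr_powr)
  have "s \<le> \<tau> \<xi> powr \<theta> \<longleftrightarrow> s' \<le> \<tau> \<xi>" if "\<xi> \<in> F" for \<xi>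
    unfolding s'(2)[symmetric] using s'(1) F(2)[OF that] \<open>0 < \<theta>\<close>
    by (metis less_imp_le not_le powr_less_mono2 powr_mono2)
  then have *: "{\<xi>. \<xi> \<in> F \<and> s \<le> \<tau> \<xi> powr \<theta>} = {\<xi>. \<xi> \<in> F \<and> s' \<le> \<tau> \<xi>}" by auto
  define W where "W = (\<Sum>\<xi> | \<xi> \<in> F \<and> s' \<le> \<tau> \<xi>. w \<xi>)"
  have "s * W powr (\<theta> * \<alpha>) = (s' * W powr \<alpha>) powr \<theta>"
    using s' by (simp add: powr_mult powr_powr mult.commute)
  also have "\<dots> \<le> S powr \<theta>"
    using S(2)[OF s'(1)] s' \<theta> by (intro powr_mono2) (auto simp: W_def)
  finally show ?thesis by (simp add: * W_def)
qed

section \<open>Coefficient bounds and pairings for a biorthogonal Riesz basis\<close>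

locale riesz_biorthogonal =
  fixes M :: "'a measure" and I :: "'i set" and u v :: "'i \<Rightarrow> 'a \<Rightarrow> complex" and a b :: real
  assumes u_L2: "\<And>\<xi>. \<xi> \<in> I \<Longrightarrow> in_Lp M 2 (u \<xi>)"
    and v_L2: "\<And>\<xi>. \<xi> \<in> I \<Longrightarrow> in_Lp M 2 (v \<xi>)"
    and v_unit: "\<And>\<xi>. \<xi> \<in> I \<Longrightarrow> L2_norm M (v \<xi>) = 1"
    and biorthogonal: "\<And>\<xi> \<eta>. \<xi> \<in> I \<Longrightarrow> \<eta> \<in> I \<Longrightarrow> L2_inner M (u \<xi>) (v \<eta>) = (if \<xi> = \<eta> then 1 else 0)"
    and a_pos: "0 < a" and b_pos: "0 < b"
    and riesz_lower: "\<And>F c. finite F \<Longrightarrow> F \<subseteq> I \<Longrightarrow>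
      a * (\<Sum>\<xi>\<in>F. (cmod (c \<xi>))\<^sup>2) \<le> (L2_norm M (\<lambda>x. \<Sum>\<xi>\<in>F. c \<xi> * u \<xi> x))\<^sup>2"
    and riesz_upper: "\<And>F c. finite F \<Longrightarrow> F \<subseteq> I \<Longrightarrow>
      (L2_norm M (\<lambda>x. \<Sum>\<xi>\<in>F. c \<xi> * u \<xi> x))\<^sup>2 \<le> b * (\<Sum>\<xi>\<in>F. (cmod (c \<xi>))\<^sup>2)"
    and span_dense: "\<And>f \<epsilon>. in_Lp M 2 f \<Longrightarrow> 0 < \<epsilon> \<Longrightarrow>
      \<exists>F c. finite F \<and> F \<subseteq> I \<and> L2_norm M (\<lambda>x. f x - (\<Sum>\<xi>\<in>F. c \<xi> * u \<xi> x)) < \<epsilon>"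
begin

text \<open>Duality with the upper Riesz bound. Pairing \<open>f\<close> with the combination whose
  coefficients are those of \<open>f\<close> itself gives X \<le> sqrt (b X) ||f||, and one factor
  sqrt X cancels.\<close>

lemma bessel_u:
  assumes F: "finite F" "F \<subseteq> I" and f: "in_Lp M 2 f"
  shows "(\<Sum>\<xi>\<in>F. (cmod (L2_inner M f (u \<xi>)))\<^sup>2) \<le> b * (L2_norm M f)\<^sup>2"
proof -
  define c where "c = (\<lambda>\<xi>. L2_inner M f (u \<xi>))"
  define X where "X = (\<Sum>\<xi>\<in>F. (cmod (c \<xi>))\<^sup>2)"
  define g where "g = (\<lambda>x. \<Sum>\<xi>\<in>F. c \<xi> * u \<xi> x)"
  have g: "in_Lp M 2 g" unfolding g_def using F u_L2 by (intro in_Lp_2_sum) auto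
  have "L2_inner M g f = (\<Sum>\<xi>\<in>F. c \<xi> * cnj (c \<xi>))"
    unfolding g_def using F u_L2 f
    by (subst L2_inner_sum_left) (auto simp: c_def L2_inner_cnj[of M "u _" f])
  also have "\<dots> = complex_of_real X"
    by (simp add: X_def complex_norm_square del: of_real_power)
  finally have *: "L2_inner M g f = complex_of_real X" .
  have "0 \<le> X" by (simp add: X_def sum_nonneg)
  then have "X \<le> L2_norm M g * L2_norm M f"
    using L2_Cauchy_Schwarz[OF g f] by (simp add: *)
  with \<open>0 \<le> X\<close> have "X\<^sup>2 \<le> (L2_norm M g * L2_norm M f)\<^sup>2"
    by (intro power_mono)
  also have "\<dots> \<le> (b * X) * (L2_norm M f)\<^sup>2"
    using riesz_upper[OF F, of c] by (simp add: power_mult_distrib g_def X_def mult_right_mono)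
  finally have "X * X \<le> X * (b * (L2_norm M f)\<^sup>2)"
    by (simp add: power2_eq_square mult_ac)
  then have "X \<le> b * (L2_norm M f)\<^sup>2"
    using \<open>0 \<le> X\<close> b_pos by (cases "X = 0") (auto simp: mult_le_cancel_left)
  then show ?thesis by (simp add: X_def c_def)
qed

text \<open>Substitute for the basis expansion. Padding the coefficients with zeros lets
  \<open>G\<close> contain any prescribed finite set, and biorthogonality recovers each coefficient
  up to the pairing of the remainder with \<open>v\<close>.\<close>

lemma approximation:
  assumes F: "finite F" "F \<subseteq> I" and f: "in_Lp M 2 f" and \<epsilon>: "0 < \<epsilon>"
  obtains G c r where "finite G" "F \<subseteq> G" "G \<subseteq> I" "in_Lp M 2 r" "L2_norm M r < \<epsilon>"
    "f = (\<lambda>x. (\<Sum>\<xi>\<in>G. c \<xi> * u \<xi> x) + r x)"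
    "\<And>\<xi>. \<xi> \<in> G \<Longrightarrow> L2_inner M f (v \<xi>) = c \<xi> + L2_inner M r (v \<xi>)"
proof -
  obtain H d where H: "finite H" "H \<subseteq> I" and lt: "L2_norm M (\<lambda>x. f x - (\<Sum>\<xi>\<in>H. d \<xi> * u \<xi> x)) < \<epsilon>"
    using span_dense[OF f \<epsilon>] by blast
  define G where "G = F \<union> H"
  define c where "c = (\<lambda>\<xi>. if \<xi> \<in> H then d \<xi> else 0)"
  define r where "r = (\<lambda>x. f x - (\<Sum>\<xi>\<in>G. c \<xi> * u \<xi> x))"
  have G: "finite G" "F \<subseteq> G" "G \<subseteq> I" using F H by (auto simp: G_def)
  have "(\<Sum>\<xi>\<in>G. c \<xi> * u \<xi> x) = (\<Sum>\<xi>\<in>H. d \<xi> * u \<xi> x)" for x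
    using G(1) by (intro sum.mono_neutral_cong_right) (auto simp: G_def c_def)
  then have small: "L2_norm M r < \<epsilon>" using lt by (simp add: r_def)
  have s: "in_Lp M 2 (\<lambda>x. \<Sum>\<xi>\<in>G. c \<xi> * u \<xi> x)" using G u_L2 by (intro in_Lp_2_sum) auto
  have r: "in_Lp M 2 r" unfolding r_def by (intro in_Lp_2_diff f s)
  have eq: "f = (\<lambda>x. (\<Sum>\<xi>\<in>G. c \<xi> * u \<xi> x) + r x)" by (simp add: r_def)
  show thesis
  proof (rule that[OF G r small eq])
    fix \<xi> assume \<xi>: "\<xi> \<in> G"
    then have "\<xi> \<in> I" using G by auto
    have "L2_inner M f (v \<xi>) = (\<Sum>\<eta>\<in>G. c \<eta> * L2_inner M (u \<eta>) (v \<xi>)) + L2_inner M r (v \<xi>)"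
      using G u_L2 v_L2[OF \<open>\<xi> \<in> I\<close>] by (subst eq, subst L2_inner_add_left[OF s r]) (auto intro!: L2_inner_sum_left)
    also have "(\<Sum>\<eta>\<in>G. c \<eta> * L2_inner M (u \<eta>) (v \<xi>)) = (\<Sum>\<eta>\<in>G. if \<eta> = \<xi> then c \<eta> else 0)"
      using G \<open>\<xi> \<in> I\<close> by (intro sum.cong) (auto simp: biorthogonal subset_iff)
    also have "\<dots> = c \<xi>" using G \<xi> by simp
    finally show "L2_inner M f (v \<xi>) = c \<xi> + L2_inner M r (v \<xi>)" .
  qed
qed

text \<open>The lower Riesz bound controls the coefficients of an approximating combination, and
  these differ little from the pairings of \<open>f\<close> with \<open>v\<close>. For fixed
  \<open>F\<close> the error can be made arbitrarily small, which leaves a bound independent of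
  \<open>F\<close>.\<close>

lemma bessel_v:
  assumes F: "finite F" "F \<subseteq> I" and f: "in_Lp M 2 f"
  shows "(\<Sum>\<xi>\<in>F. (cmod (L2_inner M f (v \<xi>)))\<^sup>2) \<le> 1 / a * (L2_norm M f)\<^sup>2"
proof -
  \<comment> \<open>A remainder of norm below \<epsilon> / L enters twice: through the norm of the
    combination, divided by sqrt a, and in each of the \<open>card F\<close> coordinates. The total
    is exactly \<epsilon>.\<close>
  define L where "L = 1 / sqrt a + sqrt (card F)"
  have L: "0 < L" using a_pos by (simp add: L_def add_pos_nonneg)
  have "L2_set (\<lambda>\<xi>. cmod (L2_inner M f (v \<xi>))) F \<le> L2_norm M f / sqrt a + \<epsilon>" if \<epsilon>: "0 < \<epsilon>" for \<epsilon>
  proof -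
    obtain G c r where G: "finite G" "F \<subseteq> G" "G \<subseteq> I" and r: "in_Lp M 2 r" "L2_norm M r < \<epsilon> / L"
      and feq: "f = (\<lambda>x. (\<Sum>\<xi>\<in>G. c \<xi> * u \<xi> x) + r x)"
      and coeff: "\<And>\<xi>. \<xi> \<in> G \<Longrightarrow> L2_inner M f (v \<xi>) = c \<xi> + L2_inner M r (v \<xi>)"
      by (rule approximation[OF F f, of "\<epsilon> / L"]) (use \<epsilon> L in auto)
    have "L2_norm M (\<lambda>x. \<Sum>\<xi>\<in>G. c \<xi> * u \<xi> x) = L2_norm M (\<lambda>x. f x + (-1) * r x)"
      by (simp add: feq)
    also have "\<dots> \<le> L2_norm M f + L2_norm M (\<lambda>x. (-1) * r x)"
      by (intro L2_norm_triangle in_Lp_2_cmult f r)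
    also have "L2_norm M (\<lambda>x. (-1) * r x) = L2_norm M r" by (simp add: L2_norm_def)
    finally have "L2_norm M (\<lambda>x. \<Sum>\<xi>\<in>G. c \<xi> * u \<xi> x) \<le> L2_norm M f + \<epsilon> / L"
      using r by simp
    then have "(L2_norm M (\<lambda>x. \<Sum>\<xi>\<in>G. c \<xi> * u \<xi> x))\<^sup>2 \<le> (L2_norm M f + \<epsilon> / L)\<^sup>2"
      by (intro power_mono) auto
    then have "a * (\<Sum>\<xi>\<in>G. (cmod (c \<xi>))\<^sup>2) \<le> (L2_norm M f + \<epsilon> / L)\<^sup>2"
      using riesz_lower[OF G(1,3), of c] by linarith
    then have "(\<Sum>\<xi>\<in>G. (cmod (c \<xi>))\<^sup>2) \<le> (L2_norm M f + \<epsilon> / L)\<^sup>2 / a"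
      using a_pos by (simp add: field_simps)
    moreover have "(\<Sum>\<xi>\<in>F. (cmod (c \<xi>))\<^sup>2) \<le> (\<Sum>\<xi>\<in>G. (cmod (c \<xi>))\<^sup>2)"
      using G by (intro sum_mono2) auto
    ultimately have "L2_set (\<lambda>\<xi>. cmod (c \<xi>)) F \<le> sqrt ((L2_norm M f + \<epsilon> / L)\<^sup>2 / a)"
      unfolding L2_set_def by (intro real_sqrt_le_mono) linarith
    also have "\<dots> = (L2_norm M f + \<epsilon> / L) / sqrt a"
      using \<epsilon> L by (simp add: real_sqrt_divide add_nonneg_nonneg)
    finally have main: "L2_set (\<lambda>\<xi>. cmod (c \<xi>)) F \<le> (L2_norm M f + \<epsilon> / L) / sqrt a" .
    have "L2_set (\<lambda>\<xi>. cmod (L2_inner M r (v \<xi>))) F \<le> L2_set (\<lambda>\<xi>. \<epsilon> / L) F"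
    proof (rule L2_set_mono)
      fix \<xi> assume "\<xi> \<in> F"
      then have "\<xi> \<in> I" using F by auto
      then show "cmod (L2_inner M r (v \<xi>)) \<le> \<epsilon> / L"
        using L2_Cauchy_Schwarz[OF r(1) v_L2] v_unit r(2) by fastforce
    qed simp
    also have "\<dots> = sqrt (card F) * (\<epsilon> / L)"
      using \<epsilon> L by (simp add: L2_set_def real_sqrt_mult real_sqrt_divide)
    finally have err: "L2_set (\<lambda>\<xi>. cmod (L2_inner M r (v \<xi>))) F \<le> sqrt (card F) * (\<epsilon> / L)" .
    have "L2_set (\<lambda>\<xi>. cmod (L2_inner M f (v \<xi>))) F
        \<le> L2_set (\<lambda>\<xi>. cmod (c \<xi>) + cmod (L2_inner M r (v \<xi>))) F"
      using coeff G by (intro L2_set_mono) (auto simp: norm_triangle_ineq)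
    also have "\<dots> \<le> L2_set (\<lambda>\<xi>. cmod (c \<xi>)) F + L2_set (\<lambda>\<xi>. cmod (L2_inner M r (v \<xi>))) F"
      by (rule L2_set_triangle_ineq)
    also have "\<dots> \<le> (L2_norm M f + \<epsilon> / L) / sqrt a + sqrt (card F) * (\<epsilon> / L)"
      using main err by linarith
    also have "\<dots> = L2_norm M f / sqrt a + L * (\<epsilon> / L)"
      by (simp add: L_def algebra_simps add_divide_distrib)
    finally show ?thesis using L by simp
  qed
  then have "L2_set (\<lambda>\<xi>. cmod (L2_inner M f (v \<xi>))) F \<le> L2_norm M f / sqrt a"
    by (rule field_le_epsilon)
  then have "(L2_set (\<lambda>\<xi>. cmod (L2_inner M f (v \<xi>))) F)\<^sup>2 \<le> (L2_norm M f / sqrt a)\<^sup>2"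
    by (intro power_mono) auto
  then show ?thesis using a_pos by (simp add: L2_set_def sum_nonneg power_divide)
qed

text \<open>Replaces the Parseval identity for the pairing of \<open>h\<close> and \<open>g\<close>:
  a bound valid for all finite partial sums of absolute values already bounds the pairing.\<close>

lemma pairing_le:
  assumes h: "in_Lp M 2 h" and g: "in_Lp M 2 g"
    and X: "\<And>G. finite G \<Longrightarrow> G \<subseteq> I \<Longrightarrow>
      (\<Sum>\<xi>\<in>G. cmod (L2_inner M h (v \<xi>)) * cmod (L2_inner M g (u \<xi>))) \<le> X"
  shows "cmod (L2_inner M h g) \<le> X"
proof (rule field_le_epsilon)
  fix \<epsilon> :: real assume \<epsilon>: "0 < \<epsilon>"
  \<comment> \<open>The first two summands multiply the norm of the remainder: the sum of its
    coefficients, by the two Bessel bounds, and its direct pairing with \<open>g\<close>. The 1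
    keeps \<open>L\<close> positive when \<open>g\<close> has norm 0.\<close>
  define L where "L = sqrt (1 / a) * (sqrt b * L2_norm M g) + L2_norm M g + 1"
  have L: "0 < L" unfolding L_def using a_pos b_pos by (intro add_nonneg_pos add_nonneg_nonneg) auto
  obtain G c r where G: "finite G" "G \<subseteq> I" and r: "in_Lp M 2 r" "L2_norm M r < \<epsilon> / L"
    and heq: "h = (\<lambda>x. (\<Sum>\<xi>\<in>G. c \<xi> * u \<xi> x) + r x)"
    and coeff: "\<And>\<xi>. \<xi> \<in> G \<Longrightarrow> L2_inner M h (v \<xi>) = c \<xi> + L2_inner M r (v \<xi>)"
    by (rule approximation[of "{}" h "\<epsilon> / L"]) (use \<epsilon> L h in auto)
  have s: "in_Lp M 2 (\<lambda>x. \<Sum>\<xi>\<in>G. c \<xi> * u \<xi> x)" using G u_L2 by (intro in_Lp_2_sum) auto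
  have "L2_inner M h g = (\<Sum>\<xi>\<in>G. c \<xi> * L2_inner M (u \<xi>) g) + L2_inner M r g"
    using G u_L2 g by (subst heq, subst L2_inner_add_left[OF s r(1)]) (auto intro!: L2_inner_sum_left)
  then have "cmod (L2_inner M h g) \<le> cmod (\<Sum>\<xi>\<in>G. c \<xi> * L2_inner M (u \<xi>) g) + cmod (L2_inner M r g)"
    by (simp add: norm_triangle_ineq)
  also have "\<dots> \<le> (\<Sum>\<xi>\<in>G. (cmod (L2_inner M h (v \<xi>)) + cmod (L2_inner M r (v \<xi>))) * cmod (L2_inner M g (u \<xi>)))
      + L2_norm M r * L2_norm M g"
  proof (rule add_mono)
    have "cmod (c \<xi> * L2_inner M (u \<xi>) g)
        \<le> (cmod (L2_inner M h (v \<xi>)) + cmod (L2_inner M r (v \<xi>))) * cmod (L2_inner M g (u \<xi>))" if "\<xi> \<in> G" for \<xi>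
    proof -
      have "c \<xi> = L2_inner M h (v \<xi>) - L2_inner M r (v \<xi>)" using coeff[OF that] by simp
      then have "cmod (c \<xi>) \<le> cmod (L2_inner M h (v \<xi>)) + cmod (L2_inner M r (v \<xi>))"
        by (simp add: norm_triangle_ineq4)
      then show ?thesis
        by (simp add: norm_mult L2_inner_cnj[of M "u \<xi>" g] mult_right_mono)
    qed
    then show "cmod (\<Sum>\<xi>\<in>G. c \<xi> * L2_inner M (u \<xi>) g)
        \<le> (\<Sum>\<xi>\<in>G. (cmod (L2_inner M h (v \<xi>)) + cmod (L2_inner M r (v \<xi>))) * cmod (L2_inner M g (u \<xi>)))"
      by (rule sum_norm_le)
  qed (rule L2_Cauchy_Schwarz[OF r(1) g])
  also have "\<dots> = (\<Sum>\<xi>\<in>G. cmod (L2_inner M h (v \<xi>)) * cmod (L2_inner M g (u \<xi>)))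
      + (\<Sum>\<xi>\<in>G. cmod (L2_inner M r (v \<xi>)) * cmod (L2_inner M g (u \<xi>))) + L2_norm M r * L2_norm M g"
    by (simp add: sum.distrib distrib_right)
  also have "(\<Sum>\<xi>\<in>G. cmod (L2_inner M r (v \<xi>)) * cmod (L2_inner M g (u \<xi>)))
      \<le> sqrt (1 / a * (L2_norm M r)\<^sup>2) * sqrt (b * (L2_norm M g)\<^sup>2)"
    by (rule order_trans[OF L2_sum_Cauchy_Schwarz], intro mult_mono real_sqrt_le_mono bessel_u bessel_v G r g)
      (use a_pos in \<open>auto intro!: sum_nonneg\<close>)
  also have "\<dots> = L2_norm M r * (sqrt (1 / a) * (sqrt b * L2_norm M g))"
    by (simp add: real_sqrt_mult real_sqrt_divide)
  also have "(\<Sum>\<xi>\<in>G. cmod (L2_inner M h (v \<xi>)) * cmod (L2_inner M g (u \<xi>))) \<le> X"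
    by (rule X[OF G])
  finally have "cmod (L2_inner M h g) \<le> X + L2_norm M r * (L - 1)"
    by (simp add: L_def algebra_simps)
  also have "L2_norm M r * (L - 1) \<le> \<epsilon> / L * L"
  proof (rule mult_mono)
    show "0 \<le> L - 1" unfolding L_def using a_pos b_pos by simp
  qed (use r \<epsilon> L in auto)
  finally show "cmod (L2_inner M h g) \<le> X + \<epsilon>" using L by simp
qed

end

locale weighted_riesz_biorthogonal = riesz_biorthogonal +
  fixes w :: "'b \<Rightarrow> real"
  assumes w_pos: "\<And>\<xi>. \<xi> \<in> I \<Longrightarrow> 0 < w \<xi>"
    and u_bound: "\<And>\<xi>. \<xi> \<in> I \<Longrightarrow> AE x in M. cmod (u \<xi> x) \<le> sqrt (w \<xi>)"
    and v_bound: "\<And>\<xi>. \<xi> \<in> I \<Longrightarrow> AE x in M. cmod (v \<xi> x) \<le> sqrt (w \<xi>)"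
begin

sublocale U: bessel_system M I u w b
  using b_pos by unfold_locales (auto intro: u_L2 u_bound w_pos bessel_u)

sublocale V: bessel_system M I v w "1 / a"
  using a_pos bessel_v by unfold_locales (auto intro: v_L2 v_bound w_pos)

text \<open>Stated for a single pair (f, h) linked by their coefficients, so no operator appears and
  the constant cannot depend on one. The weak-type condition is needed only on finite sets because
  duality and \<open>pairing_le\<close> reduce to finite sums.\<close>

lemma multiplier_bound:
  assumes pq: "1 < p" "p \<le> 2" "2 \<le> q"
    and f: "in_Lp M 2 f" "integrable M (\<lambda>x. cmod (f x) powr p)" and h: "in_Lp M 2 h"
    and mult: "\<And>\<xi>. \<xi> \<in> I \<Longrightarrow> L2_inner M h (v \<xi>) = \<sigma> \<xi> * L2_inner M f (v \<xi>)"
    and S: "0 \<le> S"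
    and weak: "\<And>F s. finite F \<Longrightarrow> F \<subseteq> I \<Longrightarrow> 0 < s \<Longrightarrow>
      s * (\<Sum>\<xi> | \<xi> \<in> F \<and> s \<le> cmod (\<sigma> \<xi>). w \<xi>) powr (1 / p - 1 / q) \<le> S"
  shows "Lp_norm M q h \<le> ennreal (sqrt (Paley_const p (1 / a)) * sqrt (Paley_const (q / (q - 1)) b)
    * S * (\<integral>x. cmod (f x) powr p \<partial>M) powr (1 / p))"
proof -
  define q' where "q' = q / (q - 1)"
  have q': "1 < q'" "q' \<le> 2" "1 / q' = 1 - 1 / q"
    using pq by (auto simp: q'_def field_simps)
  define \<alpha> where "\<alpha> = 1 / p - 1 / q"
  define \<beta> where "\<beta> = 1 / p - 1 / 2"
  have \<beta>: "0 \<le> \<beta>" "\<beta> \<le> \<alpha>" using pq by (auto simp: field_simps \<alpha>_def \<beta>_def)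
  define \<theta> where "\<theta> = \<beta> / \<alpha>"
  \<comment> \<open>For p = q = 2 both exponents vanish, and 0 / 0 = 0 gives \<theta> = 0, which
    still satisfies the identity.\<close>
  have "\<theta> * \<alpha> = \<beta>" using \<beta> by (cases "\<alpha> = 0") (auto simp: \<theta>_def)
  then have \<theta>: "0 \<le> \<theta>" "0 \<le> 1 - \<theta>" "\<theta> * \<alpha> = 1 / p - 1 / 2"
    using \<beta> by (auto simp: \<theta>_def \<beta>_def divide_le_eq_1)
  then have \<theta>': "(1 - \<theta>) * \<alpha> = 1 / q' - 1 / 2"
    by (simp add: left_diff_distrib q' \<alpha>_def)
  define C1 where "C1 = Paley_const p (1 / a)"
  define C2 where "C2 = Paley_const q' b"
  have C1: "0 \<le> C1" unfolding C1_def
    by (rule order_trans[OF _ Paley_const_ge]) (use pq a_pos in auto)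
  have C2: "0 \<le> C2" using Paley_const_ge[OF q'(1,2), of b] b_pos by (simp add: C2_def)
  define N where "N = (\<integral>x. cmod (f x) powr p \<partial>M)"
  have "0 \<le> N" unfolding N_def by (intro Bochner_Integration.integral_nonneg) simp
  have "Lp_norm M q h \<le> ennreal (sqrt C1 * sqrt C2 * S * N powr (1 / p))"
  proof (rule converse_Hoelder[OF pq(3) h])
    show "0 \<le> sqrt C1 * sqrt C2 * S * N powr (1 / p)" using C1 C2 S by simp
    fix g assume g: "in_Lp M 2 g" and "integrable M (\<lambda>x. cmod (g x) powr (q / (q - 1)))"
    then have gq: "integrable M (\<lambda>x. cmod (g x) powr q')" by (simp add: q'_def)
    define R where "R = (\<integral>x. cmod (g x) powr q' \<partial>M)"
    have "0 \<le> R" unfolding R_def by (intro Bochner_Integration.integral_nonneg) simp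
    have "cmod (L2_inner M h g) \<le> sqrt C1 * sqrt C2 * S * N powr (1 / p) * R powr (1 / q')"
    proof (rule pairing_le[OF h g])
      fix G assume G: "finite G" "G \<subseteq> I"
      \<comment> \<open>Zeros of the symbol contribute nothing to the sum, and \<open>Paley\<close>
        asks for positive weights.\<close>
      define F where "F = {\<xi>\<in>G. \<sigma> \<xi> \<noteq> 0}"
      have F: "finite F" "F \<subseteq> I" using G by (auto simp: F_def)
      have \<sigma>: "0 < cmod (\<sigma> \<xi>)" if "\<xi> \<in> F" for \<xi> using that by (simp add: F_def)
      have "(\<Sum>\<xi>\<in>G. cmod (L2_inner M h (v \<xi>)) * cmod (L2_inner M g (u \<xi>)))
          = (\<Sum>\<xi>\<in>F. cmod (\<sigma> \<xi>) * cmod (L2_inner M f (v \<xi>)) * cmod (L2_inner M g (u \<xi>)))"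
        using G mult by (intro sum.mono_neutral_cong_right) (auto simp: F_def norm_mult subset_iff)
      also have "\<dots> \<le> sqrt C1 * sqrt C2 * S * N powr (1 / p) * R powr (1 / q')"
      proof (cases "F = {}")
        case True
        then show ?thesis using C1 C2 S by simp
      next
        case False
        \<comment> \<open>One nonzero value of the symbol forces S > 0, by the weak-type condition
          at the level of that value. Positivity is used by \<open>weak_type_powr\<close> and for
          recombining S^\<theta> S^(1 - \<theta>) = S.\<close>
        then obtain \<eta> where \<eta>: "\<eta> \<in> F" by auto
        have "0 < (\<Sum>\<xi> | \<xi> \<in> F \<and> cmod (\<sigma> \<eta>) \<le> cmod (\<sigma> \<xi>). w \<xi>)"
          using F \<eta> w_pos by (intro sum_pos) auto
        then have "0 < cmod (\<sigma> \<eta>) * (\<Sum>\<xi> | \<xi> \<in> F \<and> cmod (\<sigma> \<eta>) \<le> cmod (\<sigma> \<xi>). w \<xi>) powr (1 / p - 1 / q)"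
          using \<sigma>[OF \<eta>] by simp
        then have "0 < S" using weak[OF F \<sigma>[OF \<eta>]] by linarith
        have weakF: "s * (\<Sum>\<xi> | \<xi> \<in> F \<and> s \<le> cmod (\<sigma> \<xi>) powr t. w \<xi>) powr (t * \<alpha>) \<le> S powr t"
          if "0 \<le> t" "0 < s" for s t
          using that F \<sigma> w_pos \<open>0 < S\<close> weak[OF F]
          by (intro weak_type_powr) (auto simp: \<alpha>_def intro: less_imp_le)
        have "(\<Sum>\<xi>\<in>F. cmod (\<sigma> \<xi>) * cmod (L2_inner M f (v \<xi>)) * cmod (L2_inner M g (u \<xi>)))
            = (\<Sum>\<xi>\<in>F. (cmod (L2_inner M f (v \<xi>)) * cmod (\<sigma> \<xi>) powr \<theta>)
                * (cmod (L2_inner M g (u \<xi>)) * cmod (\<sigma> \<xi>) powr (1 - \<theta>)))"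
        proof (rule sum.cong)
          fix \<xi> assume "\<xi> \<in> F"
          then have "cmod (\<sigma> \<xi>) = cmod (\<sigma> \<xi>) powr \<theta> * cmod (\<sigma> \<xi>) powr (1 - \<theta>)"
            using \<sigma> by (simp flip: powr_add)
          then show "cmod (\<sigma> \<xi>) * cmod (L2_inner M f (v \<xi>)) * cmod (L2_inner M g (u \<xi>))
            = (cmod (L2_inner M f (v \<xi>)) * cmod (\<sigma> \<xi>) powr \<theta>)
                * (cmod (L2_inner M g (u \<xi>)) * cmod (\<sigma> \<xi>) powr (1 - \<theta>))"
            by (metis mult.assoc mult.commute)
        qed simp
        also have "\<dots> \<le> sqrt (\<Sum>\<xi>\<in>F. (cmod (L2_inner M f (v \<xi>)))\<^sup>2 * (cmod (\<sigma> \<xi>) powr \<theta>)\<^sup>2)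
            * sqrt (\<Sum>\<xi>\<in>F. (cmod (L2_inner M g (u \<xi>)))\<^sup>2 * (cmod (\<sigma> \<xi>) powr (1 - \<theta>))\<^sup>2)"
          using L2_sum_Cauchy_Schwarz by (simp flip: power_mult_distrib)
        also have "\<dots> \<le> sqrt (C1 * (S powr \<theta>)\<^sup>2 * N powr (2 / p)) * sqrt (C2 * (S powr (1 - \<theta>))\<^sup>2 * R powr (2 / q'))"
        proof (intro mult_mono real_sqrt_le_mono)
          show "(\<Sum>\<xi>\<in>F. (cmod (L2_inner M f (v \<xi>)))\<^sup>2 * (cmod (\<sigma> \<xi>) powr \<theta>)\<^sup>2)
              \<le> C1 * (S powr \<theta>)\<^sup>2 * N powr (2 / p)"
            unfolding N_def C1_def using F f \<sigma> \<open>0 < S\<close> weakF[OF \<theta>(1)] by (intro V.Paley pq) (auto simp: \<theta>(3))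
          show "(\<Sum>\<xi>\<in>F. (cmod (L2_inner M g (u \<xi>)))\<^sup>2 * (cmod (\<sigma> \<xi>) powr (1 - \<theta>))\<^sup>2)
              \<le> C2 * (S powr (1 - \<theta>))\<^sup>2 * R powr (2 / q')"
            unfolding R_def C2_def using F g gq \<sigma> \<open>0 < S\<close> weakF[OF \<theta>(2)] by (intro U.Paley q') (auto simp: \<theta>')
        qed (use C1 in \<open>auto intro!: sum_nonneg\<close>)
        also have "\<dots> = sqrt C1 * sqrt C2 * (S powr \<theta> * S powr (1 - \<theta>)) * N powr (1 / p) * R powr (1 / q')"
        proof -
          have "sqrt (x powr (2 / y)) = x powr (1 / y)" if "0 \<le> x" for x y :: real
            using that by (simp add: powr_half_sqrt[symmetric] powr_powr)
          then show ?thesis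
            using \<open>0 \<le> N\<close> \<open>0 \<le> R\<close> by (simp add: real_sqrt_mult)
        qed
        also have "S powr \<theta> * S powr (1 - \<theta>) = S"
          using \<open>0 < S\<close> by (simp flip: powr_add)
        finally show ?thesis .
      qed
      finally show "(\<Sum>\<xi>\<in>G. cmod (L2_inner M h (v \<xi>)) * cmod (L2_inner M g (u \<xi>)))
          \<le> sqrt C1 * sqrt C2 * S * N powr (1 / p) * R powr (1 / q')" .
    qed
    then show "cmod (L2_inner M h g) \<le> sqrt C1 * sqrt C2 * S * N powr (1 / p) *
        (\<integral>x. cmod (g x) powr (q / (q - 1)) \<partial>M) powr (1 - 1 / q)"
      by (simp add: R_def q'(3)) (simp add: q'_def)
  qed
  then show ?thesis by (simp add: C1_def C2_def N_def q'_def)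
qed

end

section \<open>Lebesgue norms with extended values\<close>

text \<open>Compares a finite partial sum with a total that may be infinite. The case of \<infinity>
  to the power 0 is safe, as a real to the power 0 is at most 1.\<close>

lemma epow_ge:
  assumes "ennreal x \<le> X" "0 \<le> x" "0 \<le> r"
  shows "ennreal (x powr r) \<le> epow X r"
proof (cases "X = \<infinity>")
  case True
  then show ?thesis by (simp add: epow_def)
next
  case False
  then have "x \<le> enn2real X"
    using assms(1) by (cases X) (auto simp: ennreal_le_iff2)
  then show ?thesis
    using False assms by (auto simp: epow_def intro!: ennreal_leI powr_mono2)
qed

lemma Lp_norm_eq_0_imp_AE:
  assumes "0 < p" "f \<in> borel_measurable M" "Lp_norm M p f = 0"
  shows "AE x in M. f x = 0"
proof -
  have "(\<integral>\<^sup>+x. ennreal (cmod (f x) powr p) \<partial>M) = 0" (is "?X = 0")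
    using assms(1,3) by (cases "?X = \<infinity>") (auto simp: Lp_norm_def epow_def enn2real_eq_0_iff split: if_splits)
  then have "AE x in M. ennreal (cmod (f x) powr p) = 0"
    using assms(2) by (subst (asm) nn_integral_0_iff_AE) auto
  then show ?thesis by eventually_elim simp
qed

lemma Lp_norm_finiteD:
  assumes "0 < p" "f \<in> borel_measurable M" "Lp_norm M p f \<noteq> \<infinity>"
  shows "integrable M (\<lambda>x. cmod (f x) powr p)"
    and "Lp_norm M p f = ennreal ((\<integral>x. cmod (f x) powr p \<partial>M) powr (1 / p))"
proof -
  have fin: "(\<integral>\<^sup>+x. ennreal (cmod (f x) powr p) \<partial>M) \<noteq> \<infinity>"
    using assms by (auto simp: Lp_norm_def epow_def)
  then show i: "integrable M (\<lambda>x. cmod (f x) powr p)"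
    using assms(2) by (intro integrableI_bounded) (auto simp: less_top)
  have "(\<integral>\<^sup>+x. ennreal (cmod (f x) powr p) \<partial>M) = ennreal (\<integral>x. cmod (f x) powr p \<partial>M)"
    by (rule nn_integral_eq_integral[OF i]) simp
  then show "Lp_norm M p f = ennreal ((\<integral>x. cmod (f x) powr p \<partial>M) powr (1 / p))"
    by (simp add: Lp_norm_def epow_def)
qed

section \<open>From finite index sets to the operator norm in extended reals\<close>

theorem mainTheorem9:
  fixes M :: "'a measure"
    and I :: "'i set"
    and L Lstar :: "('a \<Rightarrow> complex) \<Rightarrow> ('a \<Rightarrow> complex)"
    and DomL DomLstar :: "('a \<Rightarrow> complex) set"
    and lam :: "'i \<Rightarrow> complex"
    and u v :: "'i \<Rightarrow> 'a \<Rightarrow> complex"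
    and p q :: real
  assumes sigma_fin: "sigma_finite_measure M"
    and DomL_L2: "DomL \<subseteq> {f. in_Lp M 2 f}"
    and DomLstar_L2: "DomLstar \<subseteq> {f. in_Lp M 2 f}"
    and L_L2: "\<forall>f\<in>DomL. in_Lp M 2 (L f)"
    and Lstar_L2: "\<forall>g\<in>DomLstar. in_Lp M 2 (Lstar g)"
    and adjoint: "\<forall>f\<in>DomL. \<forall>g\<in>DomLstar. L2_inner M (L f) g = L2_inner M f (Lstar g)"
    and discrete: "\<forall>R. finite {\<xi>\<in>I. cmod (lam \<xi>) \<le> R}"
    and u_eig: "\<forall>\<xi>\<in>I. u \<xi> \<in> DomL \<and> (AE x in M. L (u \<xi>) x = lam \<xi> * u \<xi> x)"
    and v_eig: "\<forall>\<xi>\<in>I. v \<xi> \<in> DomLstar \<and> (AE x in M. Lstar (v \<xi>) x = cnj (lam \<xi>) * v \<xi> x)"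
    and u_norm: "\<forall>\<xi>\<in>I. L2_norm M (u \<xi>) = 1"
    and v_norm: "\<forall>\<xi>\<in>I. L2_norm M (v \<xi>) = 1"
    and biorth: "\<forall>\<xi>\<in>I. \<forall>\<eta>\<in>I. L2_inner M (u \<xi>) (v \<eta>) = (if \<xi> = \<eta> then 1 else 0)"
    and riesz: "riesz_basis M I u"
    and u_Linf: "\<forall>\<xi>\<in>I. in_Linf M (u \<xi>)"
    and v_Linf: "\<forall>\<xi>\<in>I. in_Linf M (v \<xi>)"
    and pq: "1 < p" "p \<le> 2" "2 \<le> q"
    and sup_vu: "bdd_above ((\<lambda>\<xi>. Linf_norm M (v \<xi>) / Linf_norm M (u \<xi>)) ` I)"
    and sup_uv: "bdd_above ((\<lambda>\<xi>. Linf_norm M (u \<xi>) / Linf_norm M (v \<xi>)) ` I)"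
  shows "\<exists>C::real. C \<ge> 0 \<and>
    (\<forall>(A :: ('a \<Rightarrow> complex) \<Rightarrow> ('a \<Rightarrow> complex)) (\<sigma> :: 'i \<Rightarrow> complex).
       (\<forall>f\<in>Cinf_L M DomL L. A f \<in> Cinf_L M DomL L) \<longrightarrow>
       (\<forall>f\<in>Cinf_L M DomL L. \<forall>\<xi>\<in>I. FT_L M v (A f) \<xi> = \<sigma> \<xi> * FT_L M v f \<xi>) \<longrightarrow>
       op_norm_pq M p q (Cinf_L M DomL L) A \<le>
         ennreal C * (SUP s\<in>{0<..}. ennreal s *
            epow (\<integral>\<^sup>+ \<xi>. indicator {\<xi>\<in>I. s \<le> cmod (\<sigma> \<xi>)} \<xi> *
                     ennreal (max ((Linf_norm M (u \<xi>))\<^sup>2) ((Linf_norm M (v \<xi>))\<^sup>2)) \<partial>count_space I)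
                 (1 / p - 1 / q)))"
proof -
  have Cinf_L2: "in_Lp M 2 f" if "f \<in> Cinf_L M DomL L" for f
  proof -
    have "f \<in> Dom_pow M DomL L 0" using that unfolding Cinf_L_def by blast
    then show ?thesis by simp
  qed
  have v_L2: "in_Lp M 2 (v \<xi>)" if "\<xi> \<in> I" for \<xi>
    using v_eig DomLstar_L2 that by blast
  define w where "w = (\<lambda>\<xi>. max ((Linf_norm M (u \<xi>))\<^sup>2) ((Linf_norm M (v \<xi>))\<^sup>2))"
  note Linf_u = Linf_norm_of_unit[OF u_Linf[rule_format] u_norm[rule_format]]
    and Linf_v = Linf_norm_of_unit[OF v_Linf[rule_format] v_norm[rule_format]]
  have sqrt_w: "Linf_norm M (u \<xi>) \<le> sqrt (w \<xi>)" "Linf_norm M (v \<xi>) \<le> sqrt (w \<xi>)" for \<xi>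
    by (rule real_le_rsqrt; simp add: w_def)+
  obtain a b where ab: "0 < a" "a \<le> b"
    and frame: "\<forall>F c. finite F \<longrightarrow> F \<subseteq> I \<longrightarrow>
           a * (\<Sum>\<xi>\<in>F. (cmod (c \<xi>))\<^sup>2) \<le> (L2_norm M (\<lambda>x. \<Sum>\<xi>\<in>F. c \<xi> * u \<xi> x))\<^sup>2 \<and>
           (L2_norm M (\<lambda>x. \<Sum>\<xi>\<in>F. c \<xi> * u \<xi> x))\<^sup>2 \<le> b * (\<Sum>\<xi>\<in>F. (cmod (c \<xi>))\<^sup>2)"
    using riesz unfolding riesz_basis_def by (elim conjE exE) (rule that)
  interpret weighted_riesz_biorthogonal M I u v a b w
  proof unfold_locales
    show "in_Lp M 2 (u \<xi>)" if "\<xi> \<in> I" for \<xi>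
      using riesz that by (simp add: riesz_basis_def)
    show "\<exists>F c. finite F \<and> F \<subseteq> I \<and> L2_norm M (\<lambda>x. f x - (\<Sum>\<xi>\<in>F. c \<xi> * u \<xi> x)) < \<epsilon>"
      if "in_Lp M 2 f" "0 < \<epsilon>" for f \<epsilon>
      using riesz that unfolding riesz_basis_def by blast
    show "0 < w \<xi>" if "\<xi> \<in> I" for \<xi>
      using Linf_u(2)[OF that that] by (simp add: w_def less_max_iff_disj)
    show "AE x in M. cmod (u \<xi> x) \<le> sqrt (w \<xi>)" if "\<xi> \<in> I" for \<xi>
      using Linf_u(1)[OF that that] by eventually_elim (rule order_trans[OF _ sqrt_w(1)])
    show "AE x in M. cmod (v \<xi> x) \<le> sqrt (w \<xi>)" if "\<xi> \<in> I" for \<xi>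
      using Linf_v(1)[OF that that] by eventually_elim (rule order_trans[OF _ sqrt_w(2)])
    show "a * (\<Sum>\<xi>\<in>F. (cmod (c \<xi>))\<^sup>2) \<le> (L2_norm M (\<lambda>x. \<Sum>\<xi>\<in>F. c \<xi> * u \<xi> x))\<^sup>2"
      "(L2_norm M (\<lambda>x. \<Sum>\<xi>\<in>F. c \<xi> * u \<xi> x))\<^sup>2 \<le> b * (\<Sum>\<xi>\<in>F. (cmod (c \<xi>))\<^sup>2)"
      if "finite F" "F \<subseteq> I" for F c
      using frame that by blast+
  qed (use ab v_L2 v_norm biorth in auto)
  define \<alpha> where "\<alpha> = 1 / p - 1 / q"
  have \<alpha>: "0 \<le> \<alpha>" using pq by (simp add: \<alpha>_def field_simps)
  define C0 where "C0 = sqrt (Paley_const p (1 / a)) * sqrt (Paley_const (q / (q - 1)) b)"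
  have "0 \<le> Paley_const p (1 / a)"
    by (rule order_trans[OF _ Paley_const_ge]) (use pq ab in auto)
  moreover have "0 \<le> Paley_const (q / (q - 1)) b"
    by (rule order_trans[OF _ Paley_const_ge]) (use pq ab in \<open>auto simp: field_simps\<close>)
  ultimately have C0: "0 \<le> C0" by (simp add: C0_def)
  \<comment> \<open>A function whose coefficients all vanish is the image of 0 under the zero
    symbol. Superlevel sets of that symbol are empty, so \<open>multiplier_bound\<close> applies
    with S = 0.\<close>
  have Lq_zero: "Lp_norm M q h = 0"
    if "in_Lp M 2 h" "\<And>\<xi>. \<xi> \<in> I \<Longrightarrow> L2_inner M h (v \<xi>) = 0" for h
  proof -
    have "s * (\<Sum>\<xi> | \<xi> \<in> F \<and> s \<le> cmod 0. w \<xi>) powr (1 / p - 1 / q) \<le> 0" if "0 < s" for F s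
    proof -
      have "{\<xi>. \<xi> \<in> F \<and> s \<le> cmod 0} = {}" using that by auto
      then show ?thesis by (simp only: sum.empty) simp
    qed
    then show ?thesis
      using multiplier_bound[OF pq, of "\<lambda>_. 0" h "\<lambda>_. 0" 0] that by (simp add: in_Lp_2_iff L2_inner_def)
  qed
  show ?thesis
  \<comment> \<open>\<open>C0\<close> has been shown nonnegative only. Adding 1 makes the constant
    positive, so its product with \<infinity> is \<infinity> and not 0.\<close>
  proof (intro exI[of _ "C0 + 1"] conjI allI impI)
    show "0 \<le> C0 + 1" using C0 by simp
    fix A :: "('a \<Rightarrow> complex) \<Rightarrow> 'a \<Rightarrow> complex" and \<sigma> :: "'i \<Rightarrow> complex"
    assume A: "\<forall>f\<in>Cinf_L M DomL L. A f \<in> Cinf_L M DomL L"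
      and multiplier: "\<forall>f\<in>Cinf_L M DomL L. \<forall>\<xi>\<in>I. FT_L M v (A f) \<xi> = \<sigma> \<xi> * FT_L M v f \<xi>"
    define W where "W = (\<lambda>s. \<integral>\<^sup>+ \<xi>. indicator {\<xi>\<in>I. s \<le> cmod (\<sigma> \<xi>)} \<xi> * ennreal (w \<xi>) \<partial>count_space I)"
    define S where "S = (SUP s\<in>{0<..}. ennreal s * epow (W s) \<alpha>)"
    have weak: "ennreal (s * (\<Sum>\<xi> | \<xi> \<in> F \<and> s \<le> cmod (\<sigma> \<xi>). w \<xi>) powr \<alpha>) \<le> S"
      if F: "finite F" "F \<subseteq> I" and s: "0 < s" for F s
    proof -
      define G where "G = {\<xi>. \<xi> \<in> F \<and> s \<le> cmod (\<sigma> \<xi>)}"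
      have G: "finite G" "G \<subseteq> I" using F by (auto simp: G_def)
      have w0: "0 \<le> w \<xi>" for \<xi> by (simp add: w_def le_max_iff_disj)
      have "ennreal (\<Sum>\<xi>\<in>G. w \<xi>) = (\<Sum>\<xi>\<in>G. indicator G \<xi> * ennreal (w \<xi>))"
        using w0 by (simp flip: sum_ennreal)
      also have "\<dots> = (\<integral>\<^sup>+ \<xi>. indicator G \<xi> * ennreal (w \<xi>) \<partial>count_space I)"
        using G by (intro nn_integral_count_space'[symmetric]) auto
      also have "\<dots> \<le> W s"
        unfolding W_def using G by (intro nn_integral_mono mult_right_mono) (auto simp: G_def indicator_def)
      finally have "ennreal ((\<Sum>\<xi>\<in>G. w \<xi>) powr \<alpha>) \<le> epow (W s) \<alpha>"
        using w0 \<alpha> by (intro epow_ge sum_nonneg)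
      then have "ennreal (s * (\<Sum>\<xi>\<in>G. w \<xi>) powr \<alpha>) \<le> ennreal s * epow (W s) \<alpha>"
        using s by (simp add: ennreal_mult mult_left_mono)
      also have "\<dots> \<le> S"
        unfolding S_def using s by (intro SUP_upper) simp
      finally show ?thesis by (simp add: G_def)
    qed
    have "Lp_norm M q (A f) \<le> ennreal (C0 + 1) * S * Lp_norm M p f" if f: "f \<in> Cinf_L M DomL L" for f
    proof -
      have L2: "in_Lp M 2 f" "in_Lp M 2 (A f)" using f A Cinf_L2 by auto
      then have meas: "f \<in> borel_measurable M" by (simp add: in_Lp_2_iff)
      have coeff: "L2_inner M (A f) (v \<xi>) = \<sigma> \<xi> * L2_inner M f (v \<xi>)" if "\<xi> \<in> I" for \<xi>
        using multiplier f that by (simp add: FT_L_def L2_inner_def)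
      \<comment> \<open>In \<open>ennreal\<close> 0 times \<infinity> is 0. When \<open>S\<close> or
        the L^p norm of \<open>f\<close> is 0, the right side is 0 even if the other is infinite,
        and A f must be shown to have norm 0. Only after that does an infinite factor make the bound
        trivial.\<close>
      consider (S0) "S = 0" | (f0) "Lp_norm M p f = 0"
        | (inf) "S \<noteq> 0" "Lp_norm M p f \<noteq> 0" "S = \<infinity> \<or> Lp_norm M p f = \<infinity>"
        | (fin) "S \<noteq> \<infinity>" "Lp_norm M p f \<noteq> \<infinity>" by blast
      then show ?thesis
      proof cases
        case S0
        \<comment> \<open>The weak-type bound on the singleton of \<xi> at the level
          |\<sigma>(\<xi>)| reads |\<sigma>(\<xi>)| w^\<alpha> \<le> 0, while w > 0.\<close>
        have "\<sigma> \<xi> = 0" if "\<xi> \<in> I" for \<xi>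
        proof (rule ccontr)
          assume "\<sigma> \<xi> \<noteq> 0"
          moreover have "{\<eta>. \<eta> \<in> {\<xi>} \<and> cmod (\<sigma> \<xi>) \<le> cmod (\<sigma> \<eta>)} = {\<xi>}" by auto
          ultimately have "ennreal (cmod (\<sigma> \<xi>) * w \<xi> powr \<alpha>) \<le> 0"
            using weak[of "{\<xi>}" "cmod (\<sigma> \<xi>)"] that S0 by simp
          then have "cmod (\<sigma> \<xi>) * w \<xi> powr \<alpha> \<le> 0" by (simp add: ennreal_eq_0_iff)
          moreover have "0 < cmod (\<sigma> \<xi>) * w \<xi> powr \<alpha>"
            using \<open>\<sigma> \<xi> \<noteq> 0\<close> w_pos[OF that] by simp
          ultimately show False by linarith
        qed
        then show ?thesis using Lq_zero[OF L2(2)] coeff by simp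
      next
        case f0
        then have "AE x in M. f x = 0" using pq meas by (intro Lp_norm_eq_0_imp_AE[of p]) auto
        then have "L2_inner M f g = 0" for g
          unfolding L2_inner_def by (intro integral_eq_zero_AE) (auto elim: eventually_mono)
        then show ?thesis using Lq_zero[OF L2(2)] coeff by simp
      next
        case inf
        then have "ennreal (C0 + 1) * S * Lp_norm M p f = \<infinity>"
          using C0 by (auto simp: ennreal_mult_eq_top_iff ennreal_eq_0_iff)
        then show ?thesis by simp
      next
        case fin
        then obtain Sr where Sr: "0 \<le> Sr" "S = ennreal Sr" by (cases S) auto
        define N where "N = (\<integral>x. cmod (f x) powr p \<partial>M)"
        have N: "integrable M (\<lambda>x. cmod (f x) powr p)" "Lp_norm M p f = ennreal (N powr (1 / p))"
          unfolding N_def using Lp_norm_finiteD[OF _ meas fin(2)] pq by auto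
        have "s * (\<Sum>\<xi> | \<xi> \<in> F \<and> s \<le> cmod (\<sigma> \<xi>). w \<xi>) powr (1 / p - 1 / q) \<le> Sr"
          if "finite F" "F \<subseteq> I" "0 < s" for F s
          using weak[OF that] Sr by (simp add: \<alpha>_def)
        then have "Lp_norm M q (A f) \<le> ennreal (C0 * Sr * N powr (1 / p))"
          unfolding C0_def N_def by (intro multiplier_bound[OF pq L2(1) N(1) L2(2) coeff Sr(1)])
        also have "\<dots> \<le> ennreal ((C0 + 1) * Sr * N powr (1 / p))"
          using Sr C0 by (intro ennreal_leI mult_right_mono) auto
        also have "\<dots> = ennreal (C0 + 1) * S * Lp_norm M p f"
          using C0 Sr by (simp add: N(2) ennreal_mult)
        finally show ?thesis .
      qed
    qed
    then have "op_norm_pq M p q (Cinf_L M DomL L) A \<le> ennreal (C0 + 1) * S"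
      unfolding op_norm_pq_def by (intro Inf_lower) simp
    then show "op_norm_pq M p q (Cinf_L M DomL L) A \<le>
         ennreal (C0 + 1) * (SUP s\<in>{0<..}. ennreal s *
            epow (\<integral>\<^sup>+ \<xi>. indicator {\<xi>\<in>I. s \<le> cmod (\<sigma> \<xi>)} \<xi> *
                     ennreal (max ((Linf_norm M (u \<xi>))\<^sup>2) ((Linf_norm M (v \<xi>))\<^sup>2)) \<partial>count_space I)
                 (1 / p - 1 / q))"
      by (simp only: S_def W_def w_def \<alpha>_def)
  qed
qed

end
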